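(* Let $g=\sum_{n\ge 0}x^{n^{2}}\in\mathbb{Z}/2[[x]]$, write $\frac{1}{g}=\sum_{i\ge 0}b_{i}x^{i}$ with $b_{i}\in\mathbb{Z}/2$, and let $B=\{n\ge 0: b_{n}=1\}$. If $n\equiv 3\pmod 8$ and there are three or more primes that occur to odd exponent in the prime factorization of $n$, then $n\notin B$.
   Context: $\mathbb{Z}/2[[x]]$ is the ring of formal power series over the field with two elements; $g$ has constant term $1$ and so is invertible there. *)

theory Defs
  imports
    "HOL-Computational_Algebra.Computational_Algebra"
    "HOL-Library.Z2"
    "HOL-Number_Theory.Cong"
begin

(* bit is the two-element field; the infinite sum is taken in the X-adic metric on bit fps. *)
definition g_series :: "bit fps" where
  "g_series = (\<Sum>n. fps_X ^ (n\<^sup>2))"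

definition b_coeff :: "nat \<Rightarrow> bit" where
  "b_coeff i = fps_nth (1 / g_series) i"

definition B_set :: "nat set" where
  "B_set = {n. b_coeff n = 1}"

(* suminf and division are total, so check that the series converges and that 1 / g_series is a
   genuine inverse. *)
lemma g_series_sums: "(\<lambda>n. fps_X ^ (n\<^sup>2)) sums g_series"
  and g_series_nth: "fps_nth g_series k = of_bool (\<exists>n. k = n\<^sup>2)"
proof -
  define G :: "bit fps" where "G = Abs_fps (\<lambda>k. of_bool (\<exists>n. k = n\<^sup>2))"
  have partial: "fps_nth (\<Sum>n<N. fps_X ^ (n\<^sup>2)) k = fps_nth G k" if "N > k" for N k :: nat
  proof (cases "\<exists>n. k = n\<^sup>2")
    case True
    then obtain m where m: "k = m\<^sup>2" by blast
    have "m \<le> k" using m by (simp add: power2_nat_le_imp_le)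
    with that have mN: "m < N" by simp
    have "fps_nth (\<Sum>n<N. fps_X ^ (n\<^sup>2)) k = (\<Sum>n<N. if n = m then 1 else (0::bit))"
      unfolding fps_sum_nth by (rule sum.cong) (auto simp: fps_X_power_nth m)
    also have "\<dots> = 1" using mN by simp
    finally show ?thesis using True by (simp add: G_def)
  next
    case False
    then have "fps_nth (\<Sum>n<N. fps_X ^ (n\<^sup>2)) k = (0::bit)"
      unfolding fps_sum_nth by (intro sum.neutral) (auto simp: fps_X_power_nth)
    then show ?thesis using False by (simp add: G_def)
  qed
  have G: "(\<lambda>n. fps_X ^ (n\<^sup>2)) sums G"
    unfolding sums_def
  proof (rule tendsto_fpsI)
    fix k
    show "\<forall>\<^sub>F N in sequentially. fps_nth (\<Sum>n<N. fps_X ^ (n\<^sup>2)) k = fps_nth G k"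
      using eventually_gt_at_top[of k] by eventually_elim (rule partial)
  qed
  then have eq: "g_series = G" unfolding g_series_def by (simp add: sums_iff)
  show "(\<lambda>n. fps_X ^ (n\<^sup>2)) sums g_series" using G eq by simp
  show "fps_nth g_series k = of_bool (\<exists>n. k = n\<^sup>2)" by (simp add: eq G_def)
qed

lemma g_series_mult_inverse: "g_series * (1 / g_series) = 1"
proof -
  have "fps_nth g_series 0 \<noteq> 0" by (simp add: g_series_nth)
  then show ?thesis by (simp add: fps_divide_unit inverse_mult_eq_1')
qed

end

theory Submission
  imports Defs
begin

text \<open>
  Let \<open>h\<close> be the part of \<open>g\<close> supported on the odd squares, so that \<open>g = h + g\<^sup>4\<close>.  Over the two-element
  field this turns \<open>1 / g\<close> into \<open>h\<^sup>3 g\<^sup>8\<close> plus series without exponents congruent to 3 modulo 8.  Hence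
  for such an \<open>n\<close>, \<open>b\<^sub>n\<close> is the parity of the number of \<open>(a, b, c)\<close> with \<open>a, b > 0\<close> odd, \<open>c \<ge> 0\<close>
  and \<open>a\<^sup>2 + 2b\<^sup>2 + 8c\<^sup>2 = n\<close>.  Substituting \<open>y = \<plusminus>b + 2c\<close>, \<open>z = \<plusminus>b - 2c\<close>, twice this number is
  \<open>card V + card {v \<in> V. y = z}\<close>, where \<open>V\<close> is the set of integer vectors \<open>(x, y, z)\<close> of squared length \<open>n\<close>
  whose coordinates are congruent to 1 modulo 4.  It remains to see that 4 divides both cardinalities.

  Regard \<open>v \<in> V\<close> as a pure quaternion, and let \<open>D\<close> be a unitary divisor of \<open>n\<close>.  The left ideal of the
  Hurwitz order generated by \<open>D\<close> and \<open>v\<close> is principal with a generator \<open>q\<close> of norm \<open>D\<close>, which is unique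
  up to sign once it is normalised to be 1 modulo 2.  Then \<open>v \<mapsto> q v q\<^sup>-\<^sup>1\<close> is an involution of \<open>V\<close> (the
  action of an ambiguous ideal class), and it commutes with the exchange of \<open>y\<close> and \<open>z\<close>.  A fixed point
  would make \<open>q\<close> commute with \<open>v\<close>, which forces \<open>D\<close> or \<open>n / D\<close> to be a square.  With three primes of odd
  exponent in \<open>n\<close>, the prime powers belonging to two of them generate a group of order 4 acting freely.
\<close>

section \<open>Hurwitz quaternions\<close>

text \<open>
  \<open>Hurwitz a b c d\<close> stands for \<open>a\<omega> + bi + cj + dk\<close> with \<open>\<omega> = (1 + i + j + k) / 2\<close>; in particular
  \<open>1 = 2\<omega> - i - j - k\<close>.
\<close>

datatype hurwitz = Hurwitz (cw: int) (ci: int) (cj: int) (ck: int)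

instantiation hurwitz :: ring_1
begin

definition "0 = Hurwitz 0 0 0 0"
definition "1 = Hurwitz 2 (-1) (-1) (-1)"
definition "x + y = Hurwitz (cw x + cw y) (ci x + ci y) (cj x + cj y) (ck x + ck y)"
definition "- x = Hurwitz (- cw x) (- ci x) (- cj x) (- ck x)"
definition "x - y = Hurwitz (cw x - cw y) (ci x - ci y) (cj x - cj y) (ck x - ck y)"
definition "x * y = (let s = ci x * ci y + cj x * cj y + ck x * ck y; t = cw x * cw y in
  Hurwitz
    (- t - cw x * (ci y + cj y + ck y) - (ci x + cj x + ck x) * cw y - 2 * s)
    (t + cw x * (ci y + ck y) + (ci x + cj x) * cw y + s + cj x * ck y - ck x * cj y)
    (t + cw x * (ci y + cj y) + (cj x + ck x) * cw y + s + ck x * ci y - ci x * ck y)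
    (t + cw x * (cj y + ck y) + (ci x + ck x) * cw y + s + ci x * cj y - cj x * ci y))"

lemmas hurwitz_ring_defs = zero_hurwitz_def one_hurwitz_def plus_hurwitz_def uminus_hurwitz_def
  minus_hurwitz_def times_hurwitz_def Let_def

instance
  by standard (auto simp: hurwitz_ring_defs algebra_simps)

end

instance hurwitz :: Rings.dvd ..

lemma hurwitz_eqI: "cw x = cw y \<Longrightarrow> ci x = ci y \<Longrightarrow> cj x = cj y \<Longrightarrow> ck x = ck y \<Longrightarrow> x = y"
  by (rule hurwitz.expand) simp

lemma of_nat_hurwitz: "(of_nat m :: hurwitz) = Hurwitz (2 * int m) (- int m) (- int m) (- int m)"
  by (induction m) (auto simp: hurwitz_ring_defs)

lemma of_int_hurwitz: "(of_int m :: hurwitz) = Hurwitz (2 * m) (- m) (- m) (- m)"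
  by (cases m rule: int_cases2) (auto simp: of_nat_hurwitz uminus_hurwitz_def)

lemma of_int_mult_hurwitz:
  "of_int m * x = Hurwitz (m * cw x) (m * ci x) (m * cj x) (m * ck x)"
  by (simp add: of_int_hurwitz times_hurwitz_def Let_def algebra_simps)

lemma of_int_commute_hurwitz: "x * of_int m = of_int m * (x :: hurwitz)"
  by (simp add: of_int_hurwitz times_hurwitz_def Let_def algebra_simps)

lemma of_int_left_commute_hurwitz: "x * (of_int m * y) = of_int m * (x * (y :: hurwitz))"
  by (metis mult.assoc of_int_commute_hurwitz)

lemma of_int_mult_cancel_hurwitz:
  assumes "m \<noteq> 0" "of_int m * x = of_int m * (y :: hurwitz)"
  shows "x = y"
  using assms by (auto simp: of_int_mult_hurwitz intro: hurwitz_eqI)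

lemma of_int_dvd_hurwitz_iff:
  "of_int m dvd (x :: hurwitz) \<longleftrightarrow> m dvd cw x \<and> m dvd ci x \<and> m dvd cj x \<and> m dvd ck x"
proof
  assume "m dvd cw x \<and> m dvd ci x \<and> m dvd cj x \<and> m dvd ck x"
  then obtain a b c d where "cw x = m * a" "ci x = m * b" "cj x = m * c" "ck x = m * d"
    by (auto elim!: dvdE)
  then have "x = of_int m * Hurwitz a b c d"
    by (auto simp: of_int_mult_hurwitz intro: hurwitz_eqI)
  then show "of_int m dvd x" by (rule dvdI)
qed (auto elim!: dvdE simp: of_int_mult_hurwitz)

section \<open>Conjugation and the reduced norm\<close>

text \<open>The conjugate of omega is omega - i - j - k, which accounts for the extra
  \<open>- cw x\<close> in the last three coordinates.\<close>

definition hconj :: "hurwitz \<Rightarrow> hurwitz" where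
  "hconj x = Hurwitz (cw x) (- cw x - ci x) (- cw x - cj x) (- cw x - ck x)"

text \<open>The reduced norm in the basis omega, i, j, k; \<open>four_hnorm\<close> rewrites it
  through the doubled coordinates in the basis 1, i, j, k.\<close>

definition hnorm :: "hurwitz \<Rightarrow> int" where
  "hnorm x = cw x ^ 2 + cw x * (ci x + cj x + ck x) + ci x ^ 2 + cj x ^ 2 + ck x ^ 2"

lemma hconj_mult: "hconj (x * y) = hconj y * hconj x"
  by (simp add: hconj_def times_hurwitz_def Let_def algebra_simps)

lemma hconj_add: "hconj (x + y) = hconj x + hconj y"
  and hconj_hconj: "hconj (hconj x) = x"
  and hconj_of_int: "hconj (of_int m) = of_int m"
  and hconj_one: "hconj 1 = 1"
  by (auto simp: hconj_def hurwitz_ring_defs of_int_hurwitz intro!: hurwitz_eqI)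

lemma mult_hconj: "x * hconj x = of_int (hnorm x)"
  and hconj_mult_self: "hconj x * x = of_int (hnorm x)"
  by (auto simp: hconj_def hnorm_def times_hurwitz_def Let_def of_int_hurwitz algebra_simps power2_eq_square)

lemma hnorm_hconj: "hnorm (hconj x) = hnorm x"
  by (simp add: hconj_def hnorm_def algebra_simps power2_eq_square)

lemma hnorm_of_int: "hnorm (of_int m) = m ^ 2"
  by (simp add: hnorm_def of_int_hurwitz algebra_simps power2_eq_square)

lemma hnorm_mult: "hnorm (x * y) = hnorm x * hnorm y"
proof -
  have "of_int (hnorm (x * y)) = x * (y * hconj y) * hconj x"
    by (simp only: mult_hconj[symmetric] hconj_mult mult.assoc)
  also have "\<dots> = of_int (hnorm y) * (x * hconj x)"
    by (simp only: mult_hconj[of y] of_int_commute_hurwitz mult.assoc)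
  also have "\<dots> = (of_int (hnorm x * hnorm y) :: hurwitz)"
    by (simp add: mult_hconj flip: of_int_mult)(simp add: mult.commute)
  finally show ?thesis by (simp add: of_int_hurwitz)
qed

lemma four_hnorm:
  "4 * hnorm x = cw x ^ 2 + (cw x + 2 * ci x) ^ 2 + (cw x + 2 * cj x) ^ 2 + (cw x + 2 * ck x) ^ 2"
  by (simp add: hnorm_def algebra_simps power2_eq_square)

lemma hnorm_nonneg: "hnorm x \<ge> 0"
  using four_hnorm[of x] by (smt (verit) zero_le_power2)

lemma hnorm_eq_0_iff: "hnorm x = 0 \<longleftrightarrow> x = 0"
proof
  assume "hnorm x = 0"
  then have "cw x ^ 2 = 0 \<and> (cw x + 2 * ci x) ^ 2 = 0 \<and> (cw x + 2 * cj x) ^ 2 = 0 \<and> (cw x + 2 * ck x) ^ 2 = 0"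
    using four_hnorm[of x] by (smt (verit) zero_le_power2)
  then show "x = 0" by (auto simp: zero_hurwitz_def intro: hurwitz_eqI)
qed (simp add: hnorm_def zero_hurwitz_def)

section \<open>Euclidean division and principal left ideals\<close>

lemma centered_remainder:
  fixes t m :: int
  assumes "m > 0"
  obtains h where "(t - 2 * m * h)\<^sup>2 \<le> m\<^sup>2"
proof
  \<comment> \<open>Adding \<open>m\<close> before the floor division rounds
    \<open>t / (2 * m)\<close> to a nearest integer, so the remainder is at most \<open>m\<close> in
    absolute value.\<close>
  let ?h = "(t + m) div (2 * m)"
  have "(t + m) mod (2 * m) = t + m - 2 * m * ?h"
    by (rule minus_mult_div_eq_mod[symmetric])
  moreover have "0 \<le> (t + m) mod (2 * m)" "(t + m) mod (2 * m) < 2 * m"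
    using assms by simp_all
  ultimately have "\<bar>t - 2 * m * ?h\<bar> \<le> \<bar>m\<bar>" using assms by linarith
  then show "(t - 2 * m * ?h)\<^sup>2 \<le> m\<^sup>2" by (simp only: abs_le_square_iff)
qed

text \<open>The quotient \<open>x * hconj q / hnorm q\<close> is rounded to a Hurwitz quaternion.
  Rounding the omega coordinate first leaves an error of at most 1/2 there; the other three
  coordinates are then rounded with this error taken into account. The total error has norm at most
  (1/4 + 1 + 1 + 1) / 4 < 1.\<close>

lemma hurwitz_euclidean:
  assumes "q \<noteq> 0"
  obtains h where "hnorm (x - h * q) < hnorm q"
proof -
  define m where "m = hnorm q"
  have m: "m > 0" using assms hnorm_nonneg[of q] hnorm_eq_0_iff[of q] unfolding m_def by linarith
  define y where "y = x * hconj q"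
  obtain a where a: "(2 * cw y - 2 * m * a)\<^sup>2 \<le> m\<^sup>2" by (rule centered_remainder[OF m])
  define w where "w = cw y - m * a"
  obtain b where b: "(w + 2 * ci y - 2 * m * b)\<^sup>2 \<le> m\<^sup>2" by (rule centered_remainder[OF m])
  obtain c where c: "(w + 2 * cj y - 2 * m * c)\<^sup>2 \<le> m\<^sup>2" by (rule centered_remainder[OF m])
  obtain d where d: "(w + 2 * ck y - 2 * m * d)\<^sup>2 \<le> m\<^sup>2" by (rule centered_remainder[OF m])
  define h where "h = Hurwitz a b c d"
  define z where "z = y - of_int m * h"
  have z: "z = Hurwitz w (ci y - m * b) (cj y - m * c) (ck y - m * d)"
    by (simp add: z_def h_def w_def of_int_mult_hurwitz minus_hurwitz_def)
  have "4 * w\<^sup>2 \<le> m\<^sup>2" using a by (simp add: w_def power2_eq_square algebra_simps)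
  moreover have "4 * hnorm z = w\<^sup>2 + (w + 2 * ci y - 2 * m * b)\<^sup>2
      + (w + 2 * cj y - 2 * m * c)\<^sup>2 + (w + 2 * ck y - 2 * m * d)\<^sup>2"
    unfolding four_hnorm z by (simp add: algebra_simps)
  moreover have "m\<^sup>2 > 0" using m by simp
  ultimately have "hnorm z < m\<^sup>2" using b c d by linarith
  moreover have "z = (x - h * q) * hconj q"
    by (simp add: z_def y_def left_diff_distrib mult.assoc mult_hconj m_def of_int_commute_hurwitz)
  ultimately have "hnorm (x - h * q) * m < m * m"
    by (simp add: hnorm_mult hnorm_hconj m_def power2_eq_square)
  then have "hnorm (x - h * q) < hnorm q" using m by (simp add: m_def)
  then show ?thesis by (rule that)
qed

text \<open>A nonzero element of least norm in the left ideal is a right divisor of every element,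
  since the Euclidean remainder stays in the ideal.\<close>

lemma left_ideal_principal:
  fixes x y :: hurwitz
  assumes "x \<noteq> 0"
  obtains \<alpha> \<beta> \<gamma> \<delta> where "x = \<gamma> * (\<alpha> * x + \<beta> * y)" "y = \<delta> * (\<alpha> * x + \<beta> * y)"
proof -
  define I where "I = {\<alpha> * x + \<beta> * y |\<alpha> \<beta>. True}"
  have x: "x \<in> I" unfolding I_def by (rule CollectI, rule exI[of _ 1], rule exI[of _ 0]) simp
  have y: "y \<in> I" unfolding I_def by (rule CollectI, rule exI[of _ 0], rule exI[of _ 1]) simp
  define q where "q = arg_min (\<lambda>z. nat (hnorm z)) (\<lambda>z. z \<in> I \<and> z \<noteq> 0)"
  have q: "q \<in> I \<and> q \<noteq> 0" unfolding q_def by (rule arg_min_natI[of _ x]) (use x assms in simp)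
  have least: "nat (hnorm q) \<le> nat (hnorm z)" if "z \<in> I" "z \<noteq> 0" for z
    unfolding q_def by (rule arg_min_nat_le) (use that in simp)
  obtain \<alpha> \<beta> where ab: "q = \<alpha> * x + \<beta> * y" using q by (auto simp: I_def)
  have multiple: "\<exists>h. z = h * q" if "z \<in> I" for z
  proof -
    obtain h where h: "hnorm (z - h * q) < hnorm q" using hurwitz_euclidean q by blast
    obtain \<alpha>' \<beta>' where "z = \<alpha>' * x + \<beta>' * y" using \<open>z \<in> I\<close> by (auto simp: I_def)
    then have "z - h * q = (\<alpha>' - h * \<alpha>) * x + (\<beta>' - h * \<beta>) * y"
      by (simp add: ab algebra_simps)
    then have "z - h * q \<in> I" by (auto simp: I_def)
    with h least[of "z - h * q"] hnorm_nonneg[of "z - h * q"] have "z - h * q = 0" by force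
    then show ?thesis by auto
  qed
  show ?thesis using multiple[OF x] multiple[OF y] that by (auto simp: ab)
qed

section \<open>Units and normalisation modulo 2\<close>

text \<open>Each class modulo 2 of odd norm contains a unit \<open>r\<close>, and left
  multiplication by \<open>hconj r\<close> moves that class to 1.\<close>

lemma odd_hnorm_associate:
  assumes "odd (hnorm q)"
  obtains u z where "hnorm u = 1" "u * q = 1 + 2 * z"
proof -
  have "\<exists>r s. hnorm r = 1 \<and> q = r + of_int 2 * s"
    supply of_int_numeral [simp del]
  proof (cases "even (cw q)")
    case False
    \<comment> \<open>Residues 0 and -1 are chosen because, next to \<open>cw r = 1\<close>, m
      coordinates equal to -1 give the norm 1 - m + m = 1.\<close>
    define s where "s = Hurwitz (cw q div 2) ((ci q + 1) div 2) ((cj q + 1) div 2) ((ck q + 1) div 2)"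
    define r where "r = q - of_int 2 * s"
    have e: "t - 2 * ((t + 1) div 2) \<in> {0, -1}" for t :: int by auto
    have "cw r = 1" using False by (simp add: r_def s_def of_int_mult_hurwitz minus_hurwitz_def) presburger
    moreover have "ci r \<in> {0, -1}" "cj r \<in> {0, -1}" "ck r \<in> {0, -1}"
      unfolding r_def s_def of_int_mult_hurwitz minus_hurwitz_def hurwitz.sel by (rule e)+
    ultimately have "hnorm r = 1" by (auto simp: hnorm_def)
    then show ?thesis by (intro exI[of _ r] exI[of _ s]) (simp add: r_def)
  next
    case True
    define s where "s = Hurwitz (cw q div 2) (ci q div 2) (cj q div 2) (ck q div 2)"
    define r where "r = q - of_int 2 * s"
    have e: "t - 2 * (t div 2) \<in> {0, 1}" for t :: int by auto
    have r0: "cw r = 0" using True by (simp add: r_def s_def of_int_mult_hurwitz minus_hurwitz_def)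
    have r: "ci r \<in> {0, 1}" "cj r \<in> {0, 1}" "ck r \<in> {0, 1}"
      unfolding r_def s_def of_int_mult_hurwitz minus_hurwitz_def hurwitz.sel by (rule e)+
    have "odd (ci q + cj q + ck q)" using assms True by (simp add: hnorm_def)
    moreover have "ci q + cj q + ck q = ci r + cj r + ck r + 2 * (ci s + cj s + ck s)"
      by (simp add: r_def of_int_mult_hurwitz minus_hurwitz_def)
    ultimately have odd: "odd (ci r + cj r + ck r)" by simp
    show ?thesis
    proof (cases "hnorm r = 1")
      case True
      then show ?thesis by (intro exI[of _ r] exI[of _ s]) (simp add: r_def)
    next
      case False
      \<comment> \<open>An odd number of ones that is not a single one leaves i + j + k. It has norm
        3, but it is congruent to 1 modulo 2, so the unit 1 serves.\<close>
      then have "r = Hurwitz 0 1 1 1" using r r0 odd by (intro hurwitz_eqI) (auto simp: hnorm_def)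
      then have "r = 1 + of_int 2 * Hurwitz (-1) 1 1 1"
        by (simp add: hurwitz_ring_defs of_int_hurwitz)
      then have "q = 1 + of_int 2 * (Hurwitz (-1) 1 1 1 + s)"
        by (simp add: r_def algebra_simps)
      then show ?thesis by (intro exI[of _ 1] exI conjI) (auto simp: hnorm_def one_hurwitz_def)
    qed
  qed
  then obtain r s where rs: "hnorm r = 1" "q = r + of_int 2 * s" by blast
  have "hconj r * q = 1 + 2 * (hconj r * s)"
    using hconj_mult_self[of r] of_int_commute_hurwitz[of "hconj r" 2] rs
    by (simp add: distrib_left mult.assoc[symmetric])
  then show ?thesis using that[of "hconj r"] rs by (simp add: hnorm_hconj)
qed

text \<open>In the basis 1, i, j, k the element \<open>e\<close> has the integer coordinates
  \<open>r\<close>, \<open>p1\<close>, \<open>p2\<close>, \<open>p3\<close>, where the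
  \<open>p\<close>s share one parity and \<open>r\<close> has the other. Their squares sum to 1, so
  the \<open>p\<close>s cannot all be odd; hence \<open>r\<close> is odd and takes up the whole
  sum.\<close>

lemma hnorm_one_cong_one:
  assumes "hnorm e = 1" "e = 1 + of_int 2 * y"
  shows "e = 1 \<or> e = -1"
proof -
  note of_int_numeral [simp del]
  define r where "r = 1 + cw y"
  define p1 p2 p3 where "p1 = cw y + 2 * ci y" "p2 = cw y + 2 * cj y" "p3 = cw y + 2 * ck y"
  note p = p1_p2_p3_def
  have "hnorm e = r\<^sup>2 + p1\<^sup>2 + p2\<^sup>2 + p3\<^sup>2"
    unfolding assms(2) by (simp add: hnorm_def r_def p hurwitz_ring_defs of_int_hurwitz
        algebra_simps power2_eq_square)
  with assms have sum: "r\<^sup>2 + p1\<^sup>2 + p2\<^sup>2 + p3\<^sup>2 = 1" by simp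
  have "even p1 = even p2" "even p1 = even p3" "even r \<noteq> even p1" by (simp_all add: p r_def)
  moreover have "p1 = 0 \<and> p2 = 0" if "odd p3" 
    using that sum zero_less_power2[of p1] zero_less_power2[of p2] zero_less_power2[of p3] zero_le_power2[of r]
    by (smt (verit) dvd_0_right zero_le_power2)
  ultimately have "p3 \<noteq> 0 \<longrightarrow> even p3" "odd r" by auto
  then have "r \<noteq> 0" "even p1" "even p2" "even p3" using \<open>even p1 = even p2\<close> \<open>even p1 = even p3\<close> \<open>even r \<noteq> even p1\<close> by auto
  then have "r\<^sup>2 > 0" by simp
  then have "r\<^sup>2 = 1" "p1\<^sup>2 = 0" "p2\<^sup>2 = 0" "p3\<^sup>2 = 0"
    using sum zero_le_power2[of p1] zero_le_power2[of p2] zero_le_power2[of p3] by linarith+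
  then have "r = 1 \<or> r = -1" "p1 = 0" "p2 = 0" "p3 = 0" by (auto simp: power2_eq_1_iff)
  then show ?thesis unfolding assms(2)
    by (auto simp: r_def p hurwitz_ring_defs of_int_hurwitz intro!: hurwitz_eqI)
qed

section \<open>Ambiguous ideals acting on sums of three odd squares\<close>

definition pure :: "int \<times> int \<times> int \<Rightarrow> hurwitz" where
  "pure v = (case v of (x, y, z) \<Rightarrow> Hurwitz 0 x y z)"

text \<open>The residue 1 modulo 4 selects one of the two signs of an odd coordinate, so
  representations by odd squares are counted up to signs.\<close>

definition odd_vectors :: "int \<Rightarrow> (int \<times> int \<times> int) set" where
  "odd_vectors n = {(x, y, z). [x = 1] (mod 4) \<and> [y = 1] (mod 4) \<and> [z = 1] (mod 4) \<and> x\<^sup>2 + y\<^sup>2 + z\<^sup>2 = n}"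

text \<open>The divisibility condition forces \<open>q\<close> to be a generator of the left ideal generated by \<open>D\<close> and \<open>v\<close>.\<close>

definition conj_by :: "int \<Rightarrow> hurwitz \<Rightarrow> hurwitz \<Rightarrow> hurwitz \<Rightarrow> bool" where
  "conj_by D q v w \<longleftrightarrow> hnorm q = D \<and> q * v = w * q \<and> of_int D dvd q * v"

text \<open>Generators of the left ideal differ by units on the left. The congruence to 1 modulo 2
  reduces this freedom to a sign, which conjugation does not see, and it also makes conjugation
  preserve residues modulo 4.\<close>

definition neighbour :: "int \<Rightarrow> int \<times> int \<times> int \<Rightarrow> int \<times> int \<times> int \<Rightarrow> bool" where
  "neighbour D v w \<longleftrightarrow> (\<exists>z. conj_by D (1 + of_int 2 * z) (pure v) (pure w))"

lemma hconj_pure: "hconj (pure v) = - pure v"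
  by (auto simp: hconj_def pure_def uminus_hurwitz_def split: prod.split)

lemma hconj_eq_uminus_iff: "hconj w = - w \<longleftrightarrow> (\<exists>v. w = pure v)"
proof
  assume "hconj w = - w"
  then have "w = pure (ci w, cj w, ck w)"
    by (auto simp: hconj_def uminus_hurwitz_def pure_def intro: hurwitz_eqI)
  then show "\<exists>v. w = pure v" ..
qed (auto simp: hconj_pure)

lemma pure_inject: "pure v = pure w \<longleftrightarrow> v = w"
  by (auto simp: pure_def split: prod.splits)

lemma hnorm_pure: "v \<in> odd_vectors n \<Longrightarrow> hnorm (pure v) = n"
  by (auto simp: pure_def odd_vectors_def hnorm_def)

lemma pure_square:
  assumes "v \<in> odd_vectors n"
  shows "pure v * pure v = - of_int n"
  using mult_hconj[of "pure v"] assms by (simp add: hconj_pure hnorm_pure) (metis minus_minus)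

text \<open>Conjugating \<open>q * pure v = pure w * q\<close> reverses both products, and the signs
  from \<open>hconj_pure\<close> cancel.\<close>

lemma conj_by_sym:
  assumes "conj_by D q (pure v) (pure w)"
  shows "conj_by D (hconj q) (pure w) (pure v)"
proof -
  from assms obtain r where r: "hnorm q = D" "q * pure v = pure w * q" "q * pure v = of_int D * r"
    by (auto simp: conj_by_def elim!: dvdE)
  have 1: "hconj (q * pure v) = - (pure v * hconj q)" by (simp add: hconj_mult hconj_pure)
  have "hconj (pure w * q) = - (hconj q * pure w)" by (simp add: hconj_mult hconj_pure)
  with 1 r have 2: "hconj q * pure w = pure v * hconj q" by simp
  have "hconj (q * pure v) = of_int D * hconj r"
    by (simp add: r(3) hconj_mult hconj_of_int of_int_commute_hurwitz)
  then have "hconj q * pure w = of_int D * (- hconj r)" using 1 2 by (metis minus_minus mult_minus_right)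
  then show ?thesis using 2 r(1) unfolding conj_by_def hnorm_hconj by (blast intro: dvdI)
qed

lemma neighbour_sym:
  assumes "neighbour D v w"
  shows "neighbour D w v"
proof -
  from assms obtain z where "conj_by D (1 + of_int 2 * z) (pure v) (pure w)" by (auto simp: neighbour_def)
  then have "conj_by D (hconj (1 + of_int 2 * z)) (pure w) (pure v)" by (rule conj_by_sym)
  moreover have "hconj (1 + of_int 2 * z) = 1 + of_int 2 * hconj z"
    by (simp add: hconj_add hconj_one hconj_mult hconj_of_int del: of_int_numeral)
       (simp only: of_int_commute_hurwitz)
  ultimately show ?thesis by (auto simp: neighbour_def)
qed

text \<open>In \<open>q2 * q1 * u = q2 * v * q1\<close> the factor \<open>D1\<close> comes out of
  \<open>q1 * u\<close> and \<open>D2\<close> out of \<open>q2 * v\<close>; coprimality combines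
  them coordinatewise.\<close>

lemma conj_by_mult:
  assumes "conj_by D1 q1 u v" "conj_by D2 q2 v w" "coprime D1 D2"
  shows "conj_by (D1 * D2) (q2 * q1) u w"
proof -
  from assms(1) obtain r1 where r1: "q1 * u = of_int D1 * r1" unfolding conj_by_def by (blast elim: dvdE)
  from assms(2) obtain r2 where r2: "q2 * v = of_int D2 * r2" unfolding conj_by_def by (blast elim: dvdE)
  have n: "hnorm (q2 * q1) = D1 * D2" using assms by (simp add: conj_by_def hnorm_mult)
  have "q1 * u = v * q1" "q2 * v = w * q2" using assms by (auto simp: conj_by_def)
  then have e1: "q2 * q1 * u = q2 * v * q1" and e2: "q2 * v * q1 = w * (q2 * q1)"
    by (metis mult.assoc)+
  have "q2 * q1 * u = w * (q2 * q1)" using e1 e2 by (rule trans)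
  note e = this
  have "q2 * q1 * u = of_int D1 * (q2 * r1)"
    by (simp only: mult.assoc r1) (simp only: mult.assoc[symmetric] of_int_commute_hurwitz)
  moreover have "q2 * q1 * u = of_int D2 * (r2 * q1)" using r2 unfolding e1 by (metis mult.assoc)
  ultimately have "of_int D1 dvd q2 * q1 * u" "of_int D2 dvd q2 * q1 * u" by (metis dvdI)+
  then have "of_int (D1 * D2) dvd q2 * q1 * u"
    using assms(3) by (auto simp only: of_int_dvd_hurwitz_iff divides_mult)
  then show ?thesis using n e by (simp add: conj_by_def)
qed

text \<open>Applied in both orders, this will show that the actions of \<open>D1\<close> and
  \<open>D2\<close> commute, their composite being the action of \<open>D1 * D2\<close>.\<close>

lemma neighbour_mult:
  assumes "neighbour D1 u v" "neighbour D2 v w" "coprime D1 D2"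
  shows "neighbour (D1 * D2) u w"
proof -
  obtain y z where "conj_by D1 (1 + of_int 2 * y) (pure u) (pure v)"
    "conj_by D2 (1 + of_int 2 * z) (pure v) (pure w)"
    using assms by (auto simp: neighbour_def)
  then have "conj_by (D1 * D2) ((1 + of_int 2 * z) * (1 + of_int 2 * y)) (pure u) (pure w)"
    using assms(3) by (rule conj_by_mult)
  moreover have "(1 + of_int 2 * z) * (1 + of_int 2 * y) = 1 + of_int 2 * (z + y + z * (of_int 2 * y))"
    by (simp add: algebra_simps)
  ultimately show ?thesis by (auto simp: neighbour_def simp del: of_int_numeral)
qed

text \<open>Exchanging \<open>j\<close> and \<open>k\<close> reverses the orientation, hence is an anti-automorphism.\<close>

definition hswap :: "hurwitz \<Rightarrow> hurwitz" where
  "hswap q = Hurwitz (cw q) (ci q) (ck q) (cj q)"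

definition swap23 :: "int \<times> int \<times> int \<Rightarrow> int \<times> int \<times> int" where
  "swap23 v = (case v of (x, y, z) \<Rightarrow> (x, z, y))"

lemma hswap_mult: "hswap (x * y) = hswap y * hswap x"
  by (simp add: hswap_def times_hurwitz_def Let_def algebra_simps)

lemma hswap_pure: "hswap (pure v) = pure (swap23 v)"
  by (simp add: hswap_def pure_def swap23_def split: prod.split)

lemma of_int_dvd_hswap_iff: "of_int D dvd hswap x \<longleftrightarrow> of_int D dvd x"
  by (auto simp: of_int_dvd_hurwitz_iff hswap_def)

text \<open>The anti-automorphism \<open>hswap\<close> turns \<open>q * pure v = pure w * q\<close>
  into a relation leading from \<open>swap23 w\<close> to \<open>swap23 v\<close>; symmetry restores
  the direction.\<close>

lemma neighbour_swap23:
  assumes "neighbour D v w"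
  shows "neighbour D (swap23 v) (swap23 w)"
proof -
  from assms obtain z where z: "conj_by D (1 + of_int 2 * z) (pure v) (pure w)" (is "conj_by D ?q _ _")
    by (auto simp: neighbour_def)
  have "hswap ?q * pure (swap23 w) = hswap (pure w * ?q)" by (simp only: hswap_mult hswap_pure)
  also have "\<dots> = hswap (?q * pure v)" using z by (simp add: conj_by_def)
  finally have e: "hswap ?q * pure (swap23 w) = hswap (?q * pure v)" .
  moreover have "hswap (?q * pure v) = pure (swap23 v) * hswap ?q" by (simp only: hswap_mult hswap_pure)
  moreover have "of_int D dvd hswap (?q * pure v)"
    using z unfolding conj_by_def of_int_dvd_hswap_iff by blast
  moreover have "hnorm (hswap ?q) = hnorm ?q" by (simp add: hswap_def hnorm_def algebra_simps)
  ultimately have "conj_by D (hswap ?q) (pure (swap23 w)) (pure (swap23 v))"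
    using z by (simp add: conj_by_def)
  moreover have "hswap ?q = 1 + of_int 2 * hswap z"
    by (simp add: hswap_def hurwitz_ring_defs of_int_hurwitz)
  ultimately have "neighbour D (swap23 w) (swap23 v)" by (auto simp: neighbour_def simp del: of_int_numeral)
  then show ?thesis by (rule neighbour_sym)
qed

section \<open>Existence and uniqueness of the neighbour\<close>

text \<open>The norm of a generator of the left ideal of \<open>D\<close> and \<open>v\<close>
  divides both norms D^2 and D * E, hence their gcd \<open>D\<close>. Conversely \<open>D\<close>
  divides the norm of every element of the ideal.\<close>

lemma left_ideal_generator:
  assumes v: "v \<in> odd_vectors (D * E)" and D: "D > 0" "coprime D E"
  obtains \<alpha> \<beta> where "hnorm (\<alpha> * of_int D + \<beta> * pure v) = D"
proof -
  have "(of_int D :: hurwitz) \<noteq> 0" using D by (simp add: of_int_hurwitz zero_hurwitz_def)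
  then obtain \<alpha> \<beta> \<gamma> \<delta> where
    D': "of_int D = \<gamma> * (\<alpha> * of_int D + \<beta> * pure v)" and v': "pure v = \<delta> * (\<alpha> * of_int D + \<beta> * pure v)"
    by (rule left_ideal_principal)
  let ?q = "\<alpha> * of_int D + \<beta> * pure v"
  have "D\<^sup>2 = hnorm \<gamma> * hnorm ?q" using arg_cong[OF D', of hnorm] by (simp add: hnorm_of_int hnorm_mult)
  then have "hnorm ?q dvd D * D" by (simp add: power2_eq_square)
  moreover have "D * E = hnorm \<delta> * hnorm ?q"
    using arg_cong[OF v', of hnorm] hnorm_pure[OF v] by (simp add: hnorm_mult)
  then have "hnorm ?q dvd D * E" by simp
  ultimately have "hnorm ?q dvd gcd (D * D) (D * E)" by simp
  also have "gcd (D * D) (D * E) = D"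
    using D by (simp add: gcd_mult_left)
  finally have dvd1: "hnorm ?q dvd D" .
  \<comment> \<open>In the expanded norm each term involving \<open>of_int D\<close> is a multiple
    of \<open>D\<close>; the remaining one is the norm of \<open>\<beta> * pure v\<close>, a
    multiple of \<open>D * E\<close>.\<close>
  have "of_int (hnorm ?q) = ?q * hconj ?q" by (simp add: mult_hconj)
  also have "\<dots> = \<alpha> * of_int D * hconj ?q + \<beta> * pure v * hconj (\<alpha> * of_int D) + \<beta> * pure v * hconj (\<beta> * pure v)"
    by (simp add: hconj_add algebra_simps)
  also have "\<beta> * pure v * hconj (\<beta> * pure v) = of_int D * of_int (hnorm \<beta> * E)"
    by (simp only: mult_hconj hnorm_mult hnorm_pure[OF v] mult_ac flip: of_int_mult)
  also have "\<alpha> * of_int D * hconj ?q = of_int D * (\<alpha> * hconj ?q)"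
    by (simp only: of_int_left_commute_hurwitz mult.assoc)
  also have "\<beta> * pure v * hconj (\<alpha> * of_int D) = of_int D * (\<beta> * pure v * hconj \<alpha>)"
    by (simp only: hconj_mult hconj_of_int of_int_left_commute_hurwitz)
  finally have "of_int (hnorm ?q) = of_int D * (\<alpha> * hconj ?q + \<beta> * pure v * hconj \<alpha> + of_int (hnorm \<beta> * E))"
    by (simp only: distrib_left)
  then have "of_int D dvd (of_int (hnorm ?q) :: hurwitz)" by (rule dvdI)
  then have "D dvd hnorm ?q" unfolding of_int_dvd_hurwitz_iff unfolding of_int_hurwitz[of "hnorm ?q"] by simp
  with dvd1 D hnorm_nonneg[of ?q] have "hnorm ?q = D" by (simp add: zdvd_antisym_nonneg)
  then show ?thesis by (rule that)
qed

text \<open>Here \<open>q\<close> is a right divisor of \<open>D = hconj q * q\<close>, and the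
  divisibility in \<open>conj_by\<close> makes it one of \<open>pure v\<close> too. So it
  right-divides the given element of the ideal; both have norm \<open>D\<close>, hence the cofactor
  is a unit.\<close>

lemma conj_by_associate:
  assumes q: "conj_by D q (pure v) w" and q0: "hnorm (\<alpha> * of_int D + \<beta> * pure v) = D" and D: "D > 0"
  obtains e where "hnorm e = 1" "q = e * (\<alpha> * of_int D + \<beta> * pure v)"
proof -
  from q obtain r where r: "q * pure v = of_int D * r" and n: "hnorm q = D"
    unfolding conj_by_def by (blast elim: dvdE)
  have D': "of_int D = hconj q * q" by (simp add: hconj_mult_self n)
  \<comment> \<open>Left multiplication by \<open>hconj q\<close> produces the factor
    \<open>D\<close> on both sides; after cancelling it, conjugation exhibits \<open>q\<close> as a
    right divisor of \<open>pure v\<close>.\<close>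
  have "hconj q * (q * pure v) = of_int D * (hconj q * r)"
    by (simp only: r of_int_left_commute_hurwitz)
  then have "of_int D * pure v = of_int D * (hconj q * r)"
    unfolding D' mult.assoc .
  then have "pure v = hconj q * r" by (rule of_int_mult_cancel_hurwitz[rotated]) (use D in simp)
  from arg_cong[OF this, of hconj] have "- pure v = hconj r * q"
    by (simp only: hconj_mult hconj_hconj hconj_pure)
  from arg_cong[OF this, of uminus] have v': "pure v = - (hconj r * q)" by (simp only: minus_minus)
  have eq: "\<alpha> * of_int D + \<beta> * pure v = (\<alpha> * hconj q - \<beta> * hconj r) * q" (is "?q0 = ?e * q")
    unfolding D' v' by (simp add: algebra_simps)
  have "hnorm ?e * D = D" using q0 n unfolding eq by (simp add: hnorm_mult)
  then have e: "hnorm ?e = 1" using D by simp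
  then have "hconj ?e * ?q0 = q" unfolding eq by (simp add: mult.assoc[symmetric] hconj_mult_self)
  then show ?thesis using that[of "hconj ?e"] e by (simp add: hnorm_hconj)
qed

text \<open>Two admissible quaternions are unit multiples of the same generator, so they differ by a
  left unit \<open>f\<close>. Both being 1 modulo 2, so is \<open>f\<close>; thus \<open>f\<close>
  is 1 or -1, and the sign drops out of the conjugation.\<close>

lemma neighbour_unique:
  assumes v: "v \<in> odd_vectors (D * E)" and D: "D > 0" "coprime D E"
    and w: "neighbour D v w" "neighbour D v w'"
  shows "w = w'"
proof -
  obtain \<alpha> \<beta> where g: "hnorm (\<alpha> * of_int D + \<beta> * pure v) = D" (is "hnorm ?g = D")
    by (rule left_ideal_generator[OF v D])
  from w obtain z z' where
    q: "conj_by D (1 + of_int 2 * z) (pure v) (pure w)" (is "conj_by D ?q _ _") and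
    q': "conj_by D (1 + of_int 2 * z') (pure v) (pure w')" (is "conj_by D ?q' _ _")
    by (auto simp: neighbour_def)
  obtain e where e: "hnorm e = 1" "?q = e * ?g" by (rule conj_by_associate[OF q g D(1)])
  obtain e' where e': "hnorm e' = 1" "?q' = e' * ?g" by (rule conj_by_associate[OF q' g D(1)])
  have "?g = hconj e * ?q" using hconj_mult_self[of e] e by (simp only: mult.assoc[symmetric]) simp
  then have f: "?q' = (e' * hconj e) * ?q" using e' by (simp only: mult.assoc)
  define f where "f = e' * hconj e"
  have nf: "hnorm f = 1" using e e' by (simp add: f_def hnorm_mult hnorm_hconj)
  have "1 + of_int 2 * z' = f + of_int 2 * (f * z)"
    using f unfolding f_def[symmetric] by (simp only: distrib_left mult_1_right of_int_left_commute_hurwitz)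
  then have "f = 1 + of_int 2 * (z' - f * z)"
    by (simp only: right_diff_distrib) (metis add.commute add_diff_cancel_right' add_diff_eq)
  then have "f = 1 \<or> f = -1" using nf by (rule hnorm_one_cong_one[rotated])
  then have "?q' = ?q \<or> ?q' = - ?q" using f[folded f_def] by auto
  moreover have "?q * pure v = pure w * ?q" using q by (simp only: conj_by_def)
  moreover have "p' * x = y * p'" if "p' = p \<or> p' = - p" "p * x = y * p" for p p' x y :: hurwitz
    using that by auto
  ultimately have "?q' * pure v = pure w * ?q'" by blast
  moreover have "?q' * pure v = pure w' * ?q'" using q' by (simp only: conj_by_def)
  ultimately have "pure w * ?q' = pure w' * ?q'" by (rule trans[OF sym])
  then have "pure w * ?q' * hconj ?q' = pure w' * ?q' * hconj ?q'" by (rule arg_cong)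
  then have "pure w * (?q' * hconj ?q') = pure w' * (?q' * hconj ?q')" unfolding mult.assoc .
  moreover have "?q' * hconj ?q' = of_int D" using q' by (simp only: mult_hconj conj_by_def)
  ultimately have "of_int D * pure w = of_int D * pure w'" by (simp only: of_int_commute_hurwitz)
  then have "pure w = pure w'" by (rule of_int_mult_cancel_hurwitz[rotated]) (use D in simp)
  then show ?thesis by (simp add: pure_inject)
qed

text \<open>The norm is preserved because \<open>hnorm\<close> is multiplicative. For the residues,
  \<open>w - v\<close> is twice \<open>s\<close>, and modulo 2 this \<open>s\<close> is the
  commutator of \<open>z\<close> and \<open>v\<close>, which is even because all coordinates of
  \<open>v\<close> are odd.\<close>

lemma neighbour_odd_vectors:
  assumes v: "v \<in> odd_vectors n" and D: "D > 0" and vw: "neighbour D v w"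
  shows "w \<in> odd_vectors n"
proof -
  obtain z where q: "conj_by D (1 + of_int 2 * z) (pure v) (pure w)" (is "conj_by D ?q _ _")
    using vw by (auto simp: neighbour_def)
  obtain x1 x2 x3 where x: "v = (x1, x2, x3)" by (cases v)
  obtain y1 y2 y3 where y: "w = (y1, y2, y3)" by (cases w)
  have "hnorm (?q * pure v) = hnorm (pure w * ?q)" using q by (simp add: conj_by_def)
  then have "hnorm (pure w) = n" using q D hnorm_pure[OF v] by (simp add: hnorm_mult conj_by_def)
  then have n: "y1\<^sup>2 + y2\<^sup>2 + y3\<^sup>2 = n" by (simp add: y pure_def hnorm_def)
  have eq: "pure w - pure v = of_int 2 * (z * pure v - pure w * z)"
    using q unfolding conj_by_def right_diff_distrib
    by (simp only: distrib_left distrib_right mult_1_left mult_1_right of_int_left_commute_hurwitz mult.assoc)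
      (simp add: algebra_simps)
  define s where "s = z * pure v - pure w * z"
  have s: "cw s = 0" "y1 - x1 = 2 * ci s" "y2 - x2 = 2 * cj s" "y3 - x3 = 2 * ck s"
    using eq[folded s_def] by (simp_all only: x y pure_def of_int_mult_hurwitz minus_hurwitz_def prod.case hurwitz.sel hurwitz.inject) simp_all
  define t where "t = s * z"
  have s': "s = z * pure v - pure v * z - of_int 2 * t"
  proof -
    have "pure w = pure v + of_int 2 * s" using eq[folded s_def] by (simp only: diff_eq_eq add.commute)
    then show ?thesis unfolding t_def by (subst s_def) (simp only: distrib_right mult.assoc diff_diff_eq)
  qed
  have odd: "odd x1" "odd x2" "odd x3"
    using v by (auto simp: x odd_vectors_def cong_def) presburger+
  \<comment> \<open>The i coordinate of the commutator is \<open>cw z * (x3 - x2)\<close> plus an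
    even number, and the others follow cyclically; differences of odd coordinates are even.\<close>
  have "even (ci s)" "even (cj s)" "even (ck s)"
    using odd arg_cong[OF s', of ci] arg_cong[OF s', of cj] arg_cong[OF s', of ck]
    by (simp_all add: x pure_def times_hurwitz_def Let_def minus_hurwitz_def of_int_hurwitz del: of_int_numeral)
  then have "4 dvd y1 - x1" "4 dvd y2 - x2" "4 dvd y3 - x3" using s by auto
  then have "[y1 = x1] (mod 4)" "[y2 = x2] (mod 4)" "[y3 = x3] (mod 4)"
    by (simp_all add: cong_iff_dvd_diff)
  then show ?thesis using v n unfolding x y odd_vectors_def by (auto intro: cong_trans)
qed

lemma neighbour_exists:
  assumes v: "v \<in> odd_vectors (D * E)" and D: "D > 0" "coprime D E" "odd D"
  obtains w where "neighbour D v w"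
proof -
  obtain \<alpha> \<beta> where g: "hnorm (\<alpha> * of_int D + \<beta> * pure v) = D" (is "hnorm ?g = D")
    by (rule left_ideal_generator[OF v D(1,2)])
  obtain u z where u: "hnorm u = 1" "u * ?g = 1 + 2 * z"
    using odd_hnorm_associate[of ?g] g D by auto
  define q where "q = u * ?g"
  have nq: "hnorm q = D" by (simp only: q_def hnorm_mult g u(1) mult_1_left)
  \<comment> \<open>Since \<open>pure v\<close> squares to \<open>- D * E\<close>, the second
    summand also acquires the factor \<open>D\<close>, as \<open>conj_by\<close> requires.\<close>
  have "?g * pure v = of_int D * (\<alpha> * pure v) + \<beta> * (pure v * pure v)"
    by (simp only: distrib_right mult.assoc of_int_left_commute_hurwitz)
  also have "\<beta> * (pure v * pure v) = of_int D * - (of_int E * \<beta>)"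
    by (simp only: pure_square[OF v] mult_minus_right of_int_commute_hurwitz[of \<beta> "D * E"])
      (simp add: mult.assoc)
  finally have "?g * pure v = of_int D * (\<alpha> * pure v - of_int E * \<beta>)" by (simp add: algebra_simps)
  then have "q * pure v = of_int D * (u * (\<alpha> * pure v - of_int E * \<beta>))"
    by (simp only: q_def mult.assoc of_int_left_commute_hurwitz)
  then obtain r where r: "q * pure v = of_int D * r" by blast
  \<comment> \<open>This is q v q^-1, as \<open>hconj q / D\<close> is the inverse of
    \<open>q\<close>; it is integral because \<open>D\<close> has been divided out of
    \<open>q * pure v\<close>.\<close>
  define w where "w = r * hconj q"
  have wq: "q * pure v = w * q" 
    by (simp only: r w_def mult.assoc hconj_mult_self nq of_int_commute_hurwitz)
  have w: "of_int D * w = q * pure v * hconj q" by (simp add: r w_def mult.assoc)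
  \<comment> \<open>Conjugates of a pure quaternion are pure: \<open>q * pure v * hconj q\<close> is
    sent to its negative by \<open>hconj\<close>.\<close>
  have "of_int D * hconj w = of_int D * (- w)"
  proof -
    have "of_int D * hconj w = hconj (of_int D * w)" by (simp only: hconj_mult hconj_of_int of_int_commute_hurwitz)
    also have "\<dots> = - (q * pure v * hconj q)" unfolding w by (simp add: hconj_mult hconj_hconj hconj_pure mult.assoc)
    finally show ?thesis unfolding w[symmetric] by simp
  qed
  then have "hconj w = - w" by (rule of_int_mult_cancel_hurwitz[rotated]) (use D in simp)
  then obtain w' where "w = pure w'" by (auto simp: hconj_eq_uminus_iff)
  then have "conj_by D q (pure v) (pure w')" using nq wq r unfolding conj_by_def by (blast intro: dvdI)
  moreover have "q = 1 + of_int 2 * z" using u by (simp add: q_def)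
  ultimately have "neighbour D v w'" by (auto simp only: neighbour_def)
  then show ?thesis by (rule that)
qed

section \<open>Absence of fixed points\<close>

text \<open>If \<open>q\<close> commutes with \<open>v\<close>, its imaginary part is parallel to
  \<open>v\<close>. Comparing norms gives \<open>s\<close> between 0 and 4 with a^2 = D * s and m^2
  = E * (4 - s); the values 0 and 3 make \<open>E\<close> a square, 1 and 4 make \<open>D\<close> a
  square, and 2 conflicts with \<open>D\<close> being odd.\<close>

lemma neighbour_irrefl:
  assumes v: "v \<in> odd_vectors (D * E)" and D: "D > 0" "E > 0" "coprime D E"
    and nonsquare: "\<nexists>a. D = a\<^sup>2" "\<nexists>a. E = a\<^sup>2"
  shows "\<not> neighbour D v v"
proof
  assume "neighbour D v v"
  then obtain q where q: "conj_by D q (pure v) (pure v)" by (auto simp: neighbour_def)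
  obtain x y z where v': "v = (x, y, z)" by (cases v)
  define a where "a = cw q"
  \<comment> \<open>Together with \<open>a\<close>, these are twice the coordinates of
    \<open>q\<close> in the basis 1, i, j, k.\<close>
  define b c d where "b = a + 2 * ci q" "c = a + 2 * cj q" "d = a + 2 * ck q"
  note bcd = b_c_d_def
  have comm: "q * pure v = pure v * q" and "hnorm q = D" and dvd: "D dvd cw (q * pure v)"
    using q by (auto simp: conj_by_def of_int_dvd_hurwitz_iff)
  then have N: "4 * D = a\<^sup>2 + (b\<^sup>2 + c\<^sup>2 + d\<^sup>2)" using four_hnorm[of q] by (simp add: a_def bcd)
  have "cw (q * pure v) = - (b * x + c * y + d * z)"
    by (simp add: times_hurwitz_def Let_def pure_def v' bcd a_def algebra_simps)
  with dvd have "D dvd b * x + c * y + d * z" by (simp only: dvd_minus_iff)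
  then obtain m where m: "b * x + c * y + d * z = D * m" ..
  have parallel: "b * y = c * x" "c * z = d * y" "d * x = b * z"
    using comm by (simp_all add: times_hurwitz_def Let_def pure_def v' bcd a_def algebra_simps)
  have n: "x\<^sup>2 + y\<^sup>2 + z\<^sup>2 = D * E" using v by (simp add: v' odd_vectors_def)
  \<comment> \<open>Lagrange's identity: the last three squares form the cross product, which
    vanishes for parallel vectors.\<close>
  have "(b\<^sup>2 + c\<^sup>2 + d\<^sup>2) * (x\<^sup>2 + y\<^sup>2 + z\<^sup>2)
      = (b * x + c * y + d * z)\<^sup>2 + (b * y - c * x)\<^sup>2 + (c * z - d * y)\<^sup>2 + (d * x - b * z)\<^sup>2"
    by (simp add: algebra_simps power2_eq_square)
  then have "(4 * D - a\<^sup>2) * (D * E) = (D * m)\<^sup>2" using N n m parallel by simp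
  then have "D * (4 * D * E) = D * (a\<^sup>2 * E + D * m\<^sup>2)" by (simp add: algebra_simps power2_eq_square)
  then have main: "4 * D * E = a\<^sup>2 * E + D * m\<^sup>2" using D by simp
  then have "a\<^sup>2 * E = D * (4 * E - m\<^sup>2)" by (simp add: algebra_simps)
  then have "D dvd a\<^sup>2 * E" by simp
  then have "D dvd a\<^sup>2" using D by (simp add: coprime_dvd_mult_left_iff)
  then obtain s where s: "a\<^sup>2 = D * s" ..
  have "D * (4 * E) = D * (s * E + m\<^sup>2)" using main unfolding s by (simp add: algebra_simps)
  then have "4 * E = s * E + m\<^sup>2" using D by (metis less_irrefl mult_left_cancel)
  then have m2: "m\<^sup>2 = E * (4 - s)" by (simp add: algebra_simps)
  have "0 \<le> s" using s D zero_le_power2[of a] by (simp add: zero_le_mult_iff)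
  moreover have "s \<le> 4" using m2 D zero_le_power2[of m] by (simp add: zero_le_mult_iff)
  ultimately consider "s = 0" | "s = 1" | "s = 2" | "s = 3" | "s = 4" by linarith
  then show False
  proof cases
    case 1
    then have "even (m\<^sup>2)" using m2 by simp
    then have "even m" by simp
    then obtain k where "m = 2 * k" ..
    then have "E = k\<^sup>2" using m2 1 by (simp add: power_mult_distrib)
    with nonsquare show False by blast
  next
    case 2
    then have "D = a\<^sup>2" using s by simp
    with nonsquare show False by blast
  next
    case 3
    \<comment> \<open>Here \<open>D\<close> would be twice a square, whereas \<open>D * E\<close>, a
      sum of three odd squares, is odd.\<close>
    have "odd t" if "[t = 1] (mod 4)" for t :: int using that unfolding cong_def by presburger
    then have "odd x" "odd y" "odd z" using v by (auto simp: v' odd_vectors_def)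
    then have "odd (x\<^sup>2 + y\<^sup>2 + z\<^sup>2)" by simp
    then have "odd (D * E)" unfolding n .
    then have "odd D" by simp
    have "even (a\<^sup>2)" using s 3 by simp
    then have "even a" by simp
    then obtain k where "a = 2 * k" ..
    then have "D = 2 * k\<^sup>2" using s 3 by (simp add: power_mult_distrib)
    with \<open>odd D\<close> show False by simp
  next
    case 4
    then have "E = m\<^sup>2" using m2 by simp
    with nonsquare show False by blast
  next
    case 5
    then have "even (a\<^sup>2)" using s by simp
    then have "even a" by simp
    then obtain k where "a = 2 * k" ..
    then have "D = k\<^sup>2" using s 5 by (simp add: power_mult_distrib)
    with nonsquare show False by blast
  qed
qed

section \<open>A group of order four acting freely\<close>

text \<open>The commuting involutions generate a Klein four-group acting freely, so its orbits
  partition \<open>S\<close> into blocks of four.\<close>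

lemma four_dvd_card_involutions:
  assumes "finite S" and maps: "\<And>x. x \<in> S \<Longrightarrow> f x \<in> S" "\<And>x. x \<in> S \<Longrightarrow> g x \<in> S"
    and invol: "\<And>x. x \<in> S \<Longrightarrow> f (f x) = x" "\<And>x. x \<in> S \<Longrightarrow> g (g x) = x"
    and commute: "\<And>x. x \<in> S \<Longrightarrow> f (g x) = g (f x)"
    and free: "\<And>x. x \<in> S \<Longrightarrow> f x \<noteq> x" "\<And>x. x \<in> S \<Longrightarrow> g x \<noteq> x" "\<And>x. x \<in> S \<Longrightarrow> f (g x) \<noteq> x"
  shows "4 dvd card S"
proof -
  define orb where "orb x = {x, f x, g x, f (g x)}" for x
  have sub: "orb x \<subseteq> S" if "x \<in> S" for x using that maps by (auto simp: orb_def)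
  have S: "S = \<Union> (orb ` S)" using sub by (auto simp: orb_def)
  have orb_eq: "orb y = orb x" if "x \<in> S" "y \<in> orb x" for x y
  proof -
    have "f (f (g x)) = g x" "g (f (g x)) = f x" "g (f x) = f (g x)" "f (g (f (g x))) = x" "f (g (f x)) = g x" "f (g (g x)) = f x"
      using that maps invol commute by simp_all
    with that invol show ?thesis by (auto simp: orb_def)
  qed
  have card: "card (orb x) = 4" if "x \<in> S" for x
  proof -
    have "f x \<noteq> g x" using that free(3)[of x] invol(1)[of x] by metis
    moreover have "f x \<noteq> f (g x)" using that free(2)[of x] invol(1)[of x] invol(1)[of "g x"] maps by metis
    moreover have "g x \<noteq> f (g x)" using that free(1)[of "g x"] maps by metis
    ultimately show ?thesis using free[OF that] by (auto simp: orb_def)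
  qed
  have "4 dvd card (\<Union> (orb ` S))"
  proof (rule dvd_partition)
    show "\<forall>c1\<in>orb ` S. \<forall>c2\<in>orb ` S. c1 \<noteq> c2 \<longrightarrow> c1 \<inter> c2 = {}"
      using orb_eq by blast
  qed (use S assms(1) card in auto)
  with S show ?thesis by simp
qed

lemma finite_odd_vectors: "finite (odd_vectors n)"
proof (rule finite_subset)
  have "\<bar>a\<bar> \<le> a\<^sup>2" for a :: int
    using mult_left_mono[of 1 "\<bar>a\<bar>" "\<bar>a\<bar>"] by (cases "a = 0") (auto simp: power2_eq_square)
  then have *: "a \<in> {-n..n}" if "a\<^sup>2 + r = n" "r \<ge> 0" for a r :: int
    using that by (smt (verit) atLeastAtMost_iff)
  show "odd_vectors n \<subseteq> {-n..n} \<times> {-n..n} \<times> {-n..n}"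
  proof
    fix v assume "v \<in> odd_vectors n"
    then obtain x y z where v: "v = (x, y, z)" "x\<^sup>2 + y\<^sup>2 + z\<^sup>2 = n" by (auto simp: odd_vectors_def)
    then have "x \<in> {-n..n}" "y \<in> {-n..n}" "z \<in> {-n..n}"
      using *[of x "y\<^sup>2 + z\<^sup>2"] *[of y "x\<^sup>2 + z\<^sup>2"] *[of z "x\<^sup>2 + y\<^sup>2"] by auto
    then show "v \<in> {-n..n} \<times> {-n..n} \<times> {-n..n}" by (simp add: v)
  qed
qed simp

text \<open>Stated for closed subsets so that it serves both all of V and the vectors fixed by
  \<open>swap23\<close>. The six nonsquare conditions concern \<open>D1\<close>, \<open>D2\<close>,
  \<open>D1 * D2\<close> and their complementary divisors, as freeness of the three nontrivial group
  elements demands.\<close>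

lemma four_dvd_card_neighbour_closed:
  assumes S: "S \<subseteq> odd_vectors (D1 * D2 * E)"
    and closed: "\<And>D F v w. D * F = D1 * D2 * E \<Longrightarrow> D > 0 \<Longrightarrow> coprime D F \<Longrightarrow>
      v \<in> S \<Longrightarrow> w \<in> odd_vectors (D1 * D2 * E) \<Longrightarrow> neighbour D v w \<Longrightarrow> w \<in> S"
    and pos: "D1 > 0" "D2 > 0" "E > 0" and odd: "odd D1" "odd D2"
    and coprime: "coprime D1 D2" "coprime D1 E" "coprime D2 E"
    and nonsquare: "\<nexists>a. D1 = a\<^sup>2" "\<nexists>a. D2 = a\<^sup>2" "\<nexists>a. D1 * D2 = a\<^sup>2"
      "\<nexists>a. D2 * E = a\<^sup>2" "\<nexists>a. D1 * E = a\<^sup>2" "\<nexists>a. E = a\<^sup>2"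
  shows "4 dvd card S"
proof -
  let ?V = "odd_vectors (D1 * D2 * E)"
  \<comment> \<open>The choice is legitimate: for the divisors in question a neighbour exists and is
    unique.\<close>
  define T where "T D v = (SOME w. neighbour D v w)" for D v
  define unitary where "unitary D F \<longleftrightarrow> D * F = D1 * D2 * E \<and> D > 0 \<and> F > 0 \<and> coprime D F \<and> odd D
    \<and> (\<nexists>a. D = a\<^sup>2) \<and> (\<nexists>a. F = a\<^sup>2)" for D F
  have u: "unitary D1 (D2 * E)" "unitary D2 (D1 * E)" "unitary (D1 * D2) E"
    using pos odd coprime nonsquare by (auto simp: unitary_def coprime_commute mult_ac)
  have uniq: "w = w'" if "v \<in> S" "unitary D F" "neighbour D v w" "neighbour D v w'" for v D F w w'
    using that S by (intro neighbour_unique[of v D F w w']) (auto simp: unitary_def)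
  have T: "neighbour D v (T D v)" "T D v \<in> S" "T D v \<noteq> v" "T D (T D v) = v"
    if "v \<in> S" "unitary D F" for v D F
  proof -
    have v: "v \<in> odd_vectors (D * F)" and D: "D > 0" "F > 0" "coprime D F" "odd D"
      using that S by (auto simp: unitary_def)
    obtain w where "neighbour D v w" by (rule neighbour_exists[OF v D(1,3,4)])
    then show 1: "neighbour D v (T D v)" unfolding T_def by (rule someI)
    have "T D v \<in> odd_vectors (D * F)" using v D(1) 1 by (rule neighbour_odd_vectors)
    then show 2: "T D v \<in> S" using closed[OF _ D(1,3) that(1) _ 1] that(2) by (simp add: unitary_def)
    obtain w where "neighbour D (T D v) w" using \<open>T D v \<in> odd_vectors (D * F)\<close> D neighbour_exists by blast
    then have "neighbour D (T D v) (T D (T D v))" unfolding T_def[of D "T D v"] by (rule someI)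
    then show "T D (T D v) = v" using uniq[OF 2 that(2)] neighbour_sym[OF 1] by blast
    show "T D v \<noteq> v" using neighbour_irrefl[OF v D(1,2,3)] that(2) 1 by (auto simp: unitary_def)
  qed
  \<comment> \<open>Both composites are neighbours for \<open>D1 * D2\<close>. Uniqueness then
    yields commutation, and irreflexivity for \<open>D1 * D2\<close> yields freeness of the
    composite.\<close>
  have comp: "neighbour (D1 * D2) v (T D1 (T D2 v))" "neighbour (D1 * D2) v (T D2 (T D1 v))"
    if "v \<in> S" for v
    using neighbour_mult[of D2 v "T D2 v" D1 "T D1 (T D2 v)"] neighbour_mult[of D1 v "T D1 v" D2 "T D2 (T D1 v)"]
      T(1,2)[OF that u(1)] T(1,2)[OF that u(2)] T(1)[OF _ u(1)] T(1)[OF _ u(2)] coprime(1)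
    by (auto simp: mult.commute coprime_commute)
  show ?thesis
  proof (rule four_dvd_card_involutions)
    show "finite S" using S finite_odd_vectors by (rule finite_subset)
    show "T D1 (T D2 v) = T D2 (T D1 v)" if "v \<in> S" for v
      using uniq[OF that u(3)] comp[OF that] by blast
    show "T D1 (T D2 v) \<noteq> v" if "v \<in> S" for v
    proof
      assume "T D1 (T D2 v) = v"
      then have "neighbour (D1 * D2) v v" using comp[OF that] by simp
      then show False using neighbour_irrefl[of v "D1 * D2" E] u(3) that S by (auto simp: unitary_def)
    qed
  qed (use T u in auto)
qed

section \<open>The coefficients of the reciprocal series\<close>

lemma bit_fps_add_self: "x + x = (0 :: bit fps)"
proof (rule fps_ext)
  have "b + b = 0" for b :: bit by (cases b) auto
  then show "fps_nth (x + x) k = fps_nth 0 k" for k by (simp only: fps_add_nth fps_zero_nth)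
qed

text \<open>Frobenius in characteristic two: the products for \<open>i\<close> and
  \<open>k - i\<close> cancel in pairs, and only the diagonal index \<open>2 * i = k\<close>
  survives, where squaring a bit changes nothing.\<close>

lemma fps_square_nth_bit: "fps_nth (f\<^sup>2) k = (if even k then fps_nth f (k div 2) else 0)" for f :: "bit fps"
proof -
  define F where "F i = fps_nth f i * fps_nth f (k - i)" for i
  define A B C where "A = {i. i \<le> k \<and> 2 * i < k}" "B = {i. i \<le> k \<and> 2 * i > k}" "C = {i. 2 * i = k}"
  note ABC = A_B_C_def
  have fin: "finite A" "finite B" "finite C"
    by (rule finite_subset[of _ "{..k}"]; auto simp: ABC)+
  have disj: "A \<inter> B = {}" "(A \<union> B) \<inter> C = {}" by (auto simp: ABC)
  have "fps_nth (f\<^sup>2) k = sum F {0..k}" by (simp add: power2_eq_square fps_mult_nth F_def)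
  also have "{0..k} = (A \<union> B) \<union> C" by (auto simp: ABC)
  also have "sum F \<dots> = (sum F A + sum F B) + sum F C"
    using fin disj by (simp add: sum.union_disjoint)
  also have "sum F B = sum F A"
    by (rule sum.reindex_bij_witness[of _ "\<lambda>i. k - i" "\<lambda>i. k - i"]) (auto simp: ABC F_def)
  also have "sum F A + sum F A = 0" using bit_2_eq_0 by (simp flip: mult_2)
  also have "sum F C = (if even k then fps_nth f (k div 2) else 0)"
  proof (cases "even k")
    case True
    then have "C = {k div 2}" "k - k div 2 = k div 2" by (auto simp: ABC)
    then show ?thesis using True by (cases "fps_nth f (k div 2)") (auto simp: F_def)
  next
    case False
    then have "C = {}" by (auto simp: ABC)
    then show ?thesis using False by simp
  qed
  finally show ?thesis by simp
qed

definition odd_square_series :: "bit fps" where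
  "odd_square_series = Abs_fps (\<lambda>k. of_bool (\<exists>a. odd a \<and> k = a\<^sup>2))"

lemma odd_square_series_nth: "fps_nth odd_square_series k = of_bool (\<exists>a. odd a \<and> k = a\<^sup>2)"
  by (simp add: odd_square_series_def)

lemma fps_power4_nth_bit: "fps_nth (f ^ 4) k = (if 4 dvd k then fps_nth f (k div 4) else 0)" for f :: "bit fps"
proof -
  have "fps_nth (f ^ 4) k = fps_nth ((f\<^sup>2)\<^sup>2) k" by (simp flip: power_mult)
  also have "\<dots> = (if even k \<and> even (k div 2) then fps_nth f (k div 2 div 2) else 0)"
    unfolding fps_square_nth_bit by simp
  also have "even k \<and> even (k div 2) \<longleftrightarrow> 4 dvd k" by (auto elim!: dvdE)
  also have "k div 2 div 2 = k div 4" by (simp add: div_mult2_eq[symmetric])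
  finally show ?thesis .
qed

lemma fps_power8_nth_bit: "fps_nth (f ^ 8) k = (if 8 dvd k then fps_nth f (k div 8) else 0)" for f :: "bit fps"
proof -
  have "fps_nth (f ^ 8) k = fps_nth ((f ^ 4)\<^sup>2) k" by (simp flip: power_mult)
  also have "\<dots> = (if even k \<and> 4 dvd k div 2 then fps_nth f (k div 2 div 4) else 0)"
    unfolding fps_square_nth_bit fps_power4_nth_bit by simp
  also have "even k \<and> 4 dvd k div 2 \<longleftrightarrow> 8 dvd k" by (auto elim!: dvdE)
  also have "k div 2 div 4 = k div 8" by (simp add: div_mult2_eq[symmetric])
  finally show ?thesis .
qed

text \<open>By Frobenius, \<open>g_series ^ 4\<close> carries exactly the exponents 4 n^2, the even
  squares; adding it removes them from \<open>g_series\<close>.\<close>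

lemma odd_square_series_eq: "odd_square_series = g_series + g_series ^ 4"
proof (rule fps_ext)
  fix k :: nat
  have "odd k" if "\<exists>a. odd a \<and> k = a\<^sup>2" using that by auto
  moreover have "even k" if "\<exists>a. even a \<and> k = a\<^sup>2" using that by auto
  ultimately have *: "\<not> ((\<exists>a. odd a \<and> k = a\<^sup>2) \<and> (\<exists>a. even a \<and> k = a\<^sup>2))" by blast
  have "(\<exists>n. k = n\<^sup>2) \<longleftrightarrow> (\<exists>a. odd a \<and> k = a\<^sup>2) \<or> (\<exists>a. even a \<and> k = a\<^sup>2)" by blast
  moreover have "4 dvd k \<and> (\<exists>n. k div 4 = n\<^sup>2) \<longleftrightarrow> (\<exists>a. even a \<and> k = a\<^sup>2)"
  proof
    assume "4 dvd k \<and> (\<exists>n. k div 4 = n\<^sup>2)"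
    then obtain n where "k = (2 * n)\<^sup>2" by (auto simp: power_mult_distrib)
    then show "\<exists>a. even a \<and> k = a\<^sup>2" by (metis dvd_triv_left)
  next
    assume "\<exists>a. even a \<and> k = a\<^sup>2"
    then obtain n where "k = 4 * n\<^sup>2" by (auto simp: power_mult_distrib elim!: evenE)
    then show "4 dvd k \<and> (\<exists>n. k div 4 = n\<^sup>2)" by auto
  qed
  ultimately show "fps_nth odd_square_series k = fps_nth (g_series + g_series ^ 4) k"
    using * unfolding odd_square_series_nth fps_add_nth fps_power4_nth_bit g_series_nth
    by (cases "\<exists>a. odd a \<and> k = a\<^sup>2"; cases "\<exists>a. even a \<and> k = a\<^sup>2") (auto split: if_splits)
qed

section \<open>Isolating the exponents congruent to 3 modulo 8\<close>

text \<open>With u = g^3 one has h = g * (1 + u), and every summand becomes \<open>B\<close> times a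
  polynomial in \<open>u\<close>. These polynomials add up to 1 modulo 2.\<close>

lemma inverse_g_series_expansion:
  fixes g B h :: "'a :: comm_ring_1"
  assumes two: "(2 :: 'a) = 0" and B: "g * B = 1" and h: "h = g + g ^ 4"
  shows "B = h * (h\<^sup>2 * g ^ 8) + h ^ 7 * B ^ 8 + h * g ^ 4 + h\<^sup>2 + g ^ 8"
proof -
  define u where "u = g ^ 3"
  \<comment> \<open>An exponent congruent to 2 modulo 3 is one short of a power of \<open>u\<close>;
    the missing factor \<open>g\<close> is compensated by \<open>B\<close>.\<close>
  have up: "g ^ (3 * k + 2) = u ^ (k + 1) * B" for k
  proof -
    have "3 * (k + 1) = Suc (3 * k + 2)" by simp
    then have "u ^ (k + 1) * B = g ^ (3 * k + 2) * (g * B)"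
      by (simp only: u_def power_mult[symmetric] power_Suc2 mult.assoc)
    then show ?thesis by (simp add: B)
  qed
  have h': "h = g * (1 + u)" by (simp add: h u_def distrib_left flip: power_Suc)
  have "B ^ 8 = B ^ 7 * B" by (simp add: eval_nat_numeral mult_ac)
  then have "h ^ 7 * B ^ 8 = (g * B) ^ 7 * B * (1 + u) ^ 7"
    by (simp only: h' power_mult_distrib mult_ac)
  then have 1: "h ^ 7 * B ^ 8 = B * (1 + u) ^ 7" by (simp add: B)
  have 2: "h * (h\<^sup>2 * g ^ 8) = g ^ (3 * 3 + 2) * (1 + u) ^ 3"
    by (simp add: h' power_mult_distrib eval_nat_numeral mult_ac)
  have 3: "h * g ^ 4 = g ^ (3 * 1 + 2) * (1 + u)" by (simp add: h' eval_nat_numeral mult_ac)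
  have 4: "h\<^sup>2 = g ^ (3 * 0 + 2) * (1 + u)\<^sup>2" by (simp add: h' power_mult_distrib del: One_nat_def) (simp add: power2_eq_square)
  have 5: "g ^ 8 = g ^ (3 * 2 + 2)" by simp
  have "h * (h\<^sup>2 * g ^ 8) + h ^ 7 * B ^ 8 + h * g ^ 4 + h\<^sup>2 + g ^ 8
    = B * (u ^ 4 * (1 + u) ^ 3 + (1 + u) ^ 7 + u\<^sup>2 * (1 + u) + u * (1 + u)\<^sup>2 + u ^ 3)"
    unfolding 2 unfolding 1 3 4 5 up by (simp add: algebra_simps power2_eq_square power3_eq_cube)
  \<comment> \<open>The integer expansion is written with all even coefficients collected, so that
    only \<open>two\<close> remains to be applied.\<close>
  also have "u ^ 4 * (1 + u) ^ 3 + (1 + u) ^ 7 + u\<^sup>2 * (1 + u) + u * (1 + u)\<^sup>2 + u ^ 3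
    = 1 + 2 * (4 * u + 12 * u\<^sup>2 + 19 * u ^ 3 + 18 * u ^ 4 + 12 * u ^ 5 + 5 * u ^ 6 + u ^ 7)"
    by (simp add: eval_nat_numeral algebra_simps)
  finally show ?thesis by (simp add: two)
qed

definition supported_mod :: "nat \<Rightarrow> nat \<Rightarrow> 'a::zero fps \<Rightarrow> bool" where
  "supported_mod m r f \<longleftrightarrow> (\<forall>k. fps_nth f k \<noteq> 0 \<longrightarrow> [k = r] (mod m))"

lemma supported_mod_mult:
  fixes f g :: "'a::semiring_0 fps"
  assumes "supported_mod m r f" "supported_mod m s g"
  shows "supported_mod m (r + s) (f * g)"
  unfolding supported_mod_def
proof safe
  fix k assume "fps_nth (f * g) k \<noteq> 0"
  then obtain i where "i \<le> k" "fps_nth f i * fps_nth g (k - i) \<noteq> 0"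
    unfolding fps_mult_nth by (metis (mono_tags, lifting) sum.neutral atLeastAtMost_iff)
  then have "[i = r] (mod m)" "[k - i = s] (mod m)"
    using assms unfolding supported_mod_def by (metis mult_zero_left, metis mult_zero_right)
  then have "[i + (k - i) = r + s] (mod m)" by (rule cong_add)
  with \<open>i \<le> k\<close> show "[k = r + s] (mod m)" by simp
qed

lemma supported_mod_power:
  fixes f :: "'a::semiring_1 fps"
  assumes "supported_mod m r f"
  shows "supported_mod m (k * r) (f ^ k)"
proof (induction k)
  case (Suc k)
  show ?case using supported_mod_mult[OF assms Suc.IH] by simp
qed (simp add: supported_mod_def)

lemma odd_square_cong_1_mod_8:
  assumes "odd (a :: nat)"
  shows "[a\<^sup>2 = 1] (mod 8)"
proof -
  from assms obtain b where b: "a = 2 * b + 1" by (elim oddE)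
  obtain c where "b * (b + 1) = 2 * c" using evenE[of "b * (b + 1)"] by auto
  then have "a\<^sup>2 = 1 + 8 * c" by (simp add: b power2_eq_square algebra_simps)
  then show ?thesis by (simp add: cong_def)
qed

text \<open>The discarded summands have exponents 7 modulo 8, 1 modulo 4, 2 modulo 8 and 0 modulo 8
  respectively, because \<open>odd_square_series\<close> lives on exponents 1 modulo 8 and eighth
  powers on multiples of 8.\<close>

lemma b_coeff_3_mod_8:
  assumes n: "[n = 3] (mod 8)"
  shows "b_coeff n = fps_nth (odd_square_series * (odd_square_series\<^sup>2 * g_series ^ 8)) n"
proof -
  let ?B = "1 / g_series" and ?h = odd_square_series
  have two: "(2 :: bit fps) = 0" using bit_fps_add_self[of 1] by simp
  have h: "supported_mod 8 1 ?h"
    using odd_square_cong_1_mod_8 by (auto simp: supported_mod_def odd_square_series_nth)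
  have pow8: "supported_mod 8 0 (f ^ 8)" for f :: "bit fps"
    by (auto simp: supported_mod_def fps_power8_nth_bit cong_0_iff)
  have 1: "fps_nth (?h ^ 7 * ?B ^ 8) n = 0"
    using supported_mod_mult[OF supported_mod_power[OF h, of 7] pow8[of ?B]] n
    by (auto simp: supported_mod_def cong_def)
  \<comment> \<open>The factor \<open>g_series ^ 4\<close> is confined only to multiples of 4, so
    the summand containing it is excluded modulo 4.\<close>
  have mod4: "[k = r] (mod 4)" if "[k = r] (mod 8)" for k r :: nat
    using that by (rule cong_dvd_modulus_nat) simp
  from mod4 have h4: "supported_mod 4 1 ?h" using h unfolding supported_mod_def by blast
  have g4: "supported_mod 4 0 (g_series ^ 4)"
    by (auto simp: supported_mod_def fps_power4_nth_bit cong_0_iff)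
  have "\<not> [n = 1] (mod 4)" using mod4[OF n] by (simp add: cong_def)
  then have 2: "fps_nth (?h * g_series ^ 4) n = 0"
    using supported_mod_mult[OF h4 g4] by (auto simp: supported_mod_def)
  have 3: "fps_nth (?h\<^sup>2) n = 0"
    using supported_mod_power[OF h, of 2] n by (auto simp: supported_mod_def cong_def)
  have 4: "fps_nth (g_series ^ 8) n = 0"
    using pow8[of g_series] n by (auto simp: supported_mod_def cong_def)
  have "?B = ?h * (?h\<^sup>2 * g_series ^ 8) + ?h ^ 7 * ?B ^ 8 + ?h * g_series ^ 4 + ?h\<^sup>2 + g_series ^ 8"
    using two g_series_mult_inverse odd_square_series_eq by (rule inverse_g_series_expansion)
  from arg_cong[OF this, of "\<lambda>f. fps_nth f n"] show ?thesis
    by (simp only: fps_add_nth 1 2 3 4 b_coeff_def add_0_right)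
qed

section \<open>Coefficients as counts of triples\<close>

lemma fps_mult3_nth_indicator:
  fixes f g h :: "'a :: comm_semiring_1 fps" and \<alpha> \<beta> \<gamma> :: "nat \<Rightarrow> nat"
  assumes f: "\<And>k. fps_nth f k = of_bool (\<exists>a\<in>A. k = \<alpha> a)" and "inj_on \<alpha> A"
    and g: "\<And>k. fps_nth g k = of_bool (\<exists>b\<in>B. k = \<beta> b)" and "inj_on \<beta> B"
    and h: "\<And>k. fps_nth h k = of_bool (\<exists>c\<in>C. k = \<gamma> c)" and "inj_on \<gamma> C"
  shows "fps_nth (f * (g * h)) n
    = of_nat (card {(a, b, c). a \<in> A \<and> b \<in> B \<and> c \<in> C \<and> \<alpha> a + (\<beta> b + \<gamma> c) = n})" (is "_ = of_nat (card ?T)")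
proof -
  define P where "P i j \<longleftrightarrow> (\<exists>a\<in>A. i = \<alpha> a) \<and> (\<exists>b\<in>B. j = \<beta> b) \<and> (\<exists>c\<in>C. n - i - j = \<gamma> c)" for i j
  define S where "S = (SIGMA i:{0..n}. {0..n - i})"
  have "fps_nth (f * (g * h)) n = (\<Sum>i = 0..n. \<Sum>j = 0..n - i. of_bool (P i j))"
    by (simp only: fps_mult_nth f g h sum_distrib_left P_def of_bool_conj)
  also have "\<dots> = (\<Sum>(i, j)\<in>S. of_bool (P i j))" unfolding S_def by (rule sum.Sigma) auto
  also have "\<dots> = of_nat (card {x \<in> S. case x of (i, j) \<Rightarrow> P i j})"
    by (simp add: S_def case_prod_unfold Int_def sum_of_bool_eq)
  also have "card {x \<in> S. case x of (i, j) \<Rightarrow> P i j} = card ?T"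
  proof (rule sym, rule bij_betw_same_card)
    \<comment> \<open>Two exponents suffice: the third is \<open>n - i - j\<close>, and injectivity
      recovers the parameters from the exponents.\<close>
    show "bij_betw (\<lambda>(a, b, c). (\<alpha> a, \<beta> b)) ?T {x \<in> S. case x of (i, j) \<Rightarrow> P i j}"
      unfolding bij_betw_def
    proof
      show "inj_on (\<lambda>(a, b, c). (\<alpha> a, \<beta> b)) ?T"
        using assms by (auto simp: inj_on_def)
      show "(\<lambda>(a, b, c). (\<alpha> a, \<beta> b)) ` ?T = {x \<in> S. case x of (i, j) \<Rightarrow> P i j}"
      proof (intro equalityI subsetI)
        fix x assume "x \<in> {x \<in> S. case x of (i, j) \<Rightarrow> P i j}"
        then obtain i j where x: "x = (i, j)" "i + j \<le> n" "P i j" by (auto simp: S_def)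
        then obtain a b c where "a \<in> A" "i = \<alpha> a" "b \<in> B" "j = \<beta> b" "c \<in> C" "n - i - j = \<gamma> c"
          by (auto simp: P_def)
        with x show "x \<in> (\<lambda>(a, b, c). (\<alpha> a, \<beta> b)) ` ?T"
          by (intro image_eqI[of _ _ "(a, b, c)"]) auto
      qed (auto simp: S_def P_def)
    qed
  qed
  finally show ?thesis .
qed

lemma of_nat_bit_eq_0_iff: "of_nat k = (0 :: bit) \<longleftrightarrow> even k"
  by (induction k) auto

text \<open>By Frobenius the three factors of the surviving product have exponents a^2, 2 b^2 and 8
  c^2, so the coefficient is the parity of this count.\<close>

lemma even_card_imp_not_in_B_set:
  assumes n: "[n = 3] (mod 8)"
    and "even (card {(a, b, c). odd a \<and> odd b \<and> a\<^sup>2 + (2 * b\<^sup>2 + 8 * c\<^sup>2) = n})"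
  shows "n \<notin> B_set"
proof -
  let ?T = "{(a, b, c). a \<in> {a. odd a} \<and> b \<in> {b. odd b} \<and> c \<in> UNIV \<and> a\<^sup>2 + (2 * b\<^sup>2 + 8 * c\<^sup>2) = n}"
  have "b_coeff n = of_nat (card ?T)"
    unfolding b_coeff_3_mod_8[OF n]
  proof (rule fps_mult3_nth_indicator)
    show "fps_nth odd_square_series k = of_bool (\<exists>a\<in>{a. odd a}. k = a\<^sup>2)" for k
      by (simp add: odd_square_series_nth)
    show "fps_nth (odd_square_series\<^sup>2) k = of_bool (\<exists>b\<in>{b. odd b}. k = 2 * b\<^sup>2)" for k
    proof -
      have "fps_nth (odd_square_series\<^sup>2) k = of_bool (even k \<and> (\<exists>b. odd b \<and> k div 2 = b\<^sup>2))"
        by (simp add: odd_square_series_nth fps_square_nth_bit)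
      also have "even k \<and> (\<exists>b. odd b \<and> k div 2 = b\<^sup>2) \<longleftrightarrow> (\<exists>b\<in>{b. odd b}. k = 2 * b\<^sup>2)" by auto
      finally show ?thesis .
    qed
    show "fps_nth (g_series ^ 8) k = of_bool (\<exists>c\<in>UNIV. k = 8 * c\<^sup>2)" for k
    proof -
      have "fps_nth (g_series ^ 8) k = of_bool (8 dvd k \<and> (\<exists>c. k div 8 = c\<^sup>2))"
        by (simp add: g_series_nth fps_power8_nth_bit)
      also have "8 dvd k \<and> (\<exists>c. k div 8 = c\<^sup>2) \<longleftrightarrow> (\<exists>c\<in>UNIV. k = 8 * c\<^sup>2)" by auto
      finally show ?thesis .
    qed
  qed (auto simp: inj_on_def)
  with assms(2) show ?thesis by (simp add: B_set_def of_nat_bit_eq_0_iff[THEN iffD2])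
qed

section \<open>Counting representations\<close>

text \<open>The sum of (b + 2c)^2 and (b - 2c)^2 is 2 b^2 + 8 c^2, so with suitable signs the
  triples match the vectors with \<open>z \<le> y\<close>. Exchanging \<open>y\<close> and
  \<open>z\<close> matches the two strict halves, so doubling counts V once and its diagonal once
  more.\<close>

lemma card_square_triples:
  assumes n: "int n = N"
  shows "2 * card {(a, b, c). odd a \<and> odd b \<and> a\<^sup>2 + (2 * b\<^sup>2 + 8 * c\<^sup>2) = n}
    = card (odd_vectors N) + card {v \<in> odd_vectors N. swap23 v = v}" (is "2 * card ?T = card ?V + card ?Z")
proof -
  \<comment> \<open>One sign of \<open>b\<close> serves both coordinates, as they differ by
    \<open>4 * c\<close>. For odd \<open>b\<close> exactly one sign gives the residue 1 modulo
    4.\<close>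
  define G where "G x = (case x of (a, b, c) \<Rightarrow>
    let a' = (if [int a = 1] (mod 4) then int a else - int a);
        b' = (if [int b + 2 * int c = 1] (mod 4) then int b else - int b)
    in (a', b' + 2 * int c, b' - 2 * int c))" for x :: "nat \<times> nat \<times> nat"
  let ?W = "{(x, y, z). (x, y, z) \<in> ?V \<and> z \<le> y}"
  let ?L = "{(x, y, z). (x, y, z) \<in> ?V \<and> y < z}" and ?R = "{(x, y, z). (x, y, z) \<in> ?V \<and> z < y}"
  have odd_cases: "[t = 1] (mod 4) \<or> [- t = 1] (mod 4)" if "odd t" for t :: int
  proof -
    have "t mod 4 \<in> {1, 3}" using that by (auto elim!: oddE) presburger
    then show ?thesis by (auto simp: cong_def zmod_zminus1_eq_if)
  qed
  have odd1: "odd t" if "[t = 1] (mod 4)" for t :: int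
    using cong_dvd_modulus[OF that, of 2] by (simp add: cong_def odd_iff_mod_2_eq_one)
  have neg: "\<not> [- t = 1] (mod 4)" if "[t = 1] (mod 4)" for t :: int
    using cong_add[OF that, of "- t" 1] by (auto simp: cong_def)
  have shift: "[s = 1] (mod 4)" if "[t = 1] (mod 4)" "s = t + 4 * k" for s t k :: int
    using that by (simp add: cong_def)
  have "bij_betw G ?T ?W"
    unfolding bij_betw_def
  proof
    show "inj_on G ?T"
      \<comment> \<open>The inverse recovers \<open>b\<close> from half the absolute value of
        \<open>y + z\<close> and \<open>c\<close> from \<open>(y - z) div 4\<close>.\<close>
      by (rule inj_on_inverseI[where g = "\<lambda>(x, y, z). (nat \<bar>x\<bar>, nat (\<bar>y + z\<bar> div 2), nat ((y - z) div 4))"])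
        (auto simp: G_def Let_def)
    show "G ` ?T = ?W"
    proof (intro equalityI subsetI)
      fix w assume "w \<in> G ` ?T"
      then obtain a b c where abc: "odd a" "odd b" "a\<^sup>2 + (2 * b\<^sup>2 + 8 * c\<^sup>2) = n" "w = G (a, b, c)" by auto
      define x where "x = (if [int a = 1] (mod 4) then int a else - int a)"
      define y where "y = (if [int b + 2 * int c = 1] (mod 4) then int b else - int b)"
      have w: "w = (x, y + 2 * int c, y - 2 * int c)" by (simp add: abc(4) G_def x_def y_def Let_def)
      have "[x = 1] (mod 4)" using odd_cases[of "int a"] abc by (auto simp: x_def)
      moreover have "[y + 2 * int c = 1] (mod 4) \<and> [y - 2 * int c = 1] (mod 4)"
      proof (cases "[int b + 2 * int c = 1] (mod 4)")
        case True
        then have "[y + 2 * int c = 1] (mod 4)" by (simp add: y_def)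
        moreover from this have "[y - 2 * int c = 1] (mod 4)" by (rule shift[of _ _ "- int c"]) simp
        ultimately show ?thesis ..
      next
        case False
        then have "[y - 2 * int c = 1] (mod 4)"
          using odd_cases[of "int b + 2 * int c"] abc(2) by (simp add: y_def)
        moreover from this have "[y + 2 * int c = 1] (mod 4)" by (rule shift[of _ _ "int c"]) simp
        ultimately show ?thesis by simp
      qed
      moreover have "x\<^sup>2 = (int a)\<^sup>2" "y\<^sup>2 = (int b)\<^sup>2" by (auto simp: x_def y_def)
      then have "x\<^sup>2 + (y + 2 * int c)\<^sup>2 + (y - 2 * int c)\<^sup>2 = (int a)\<^sup>2 + (2 * (int b)\<^sup>2 + 8 * (int c)\<^sup>2)"
        by (simp add: power2_sum power2_diff power_mult_distrib)
      then have "x\<^sup>2 + (y + 2 * int c)\<^sup>2 + (y - 2 * int c)\<^sup>2 = N"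
        unfolding n[symmetric] abc(3)[symmetric] by simp
      ultimately show "w \<in> ?W" by (simp add: w odd_vectors_def)
    next
      fix w assume "w \<in> ?W"
      then obtain x y z where w: "w = (x, y, z)" "z \<le> y" "[x = 1] (mod 4)" "[y = 1] (mod 4)" "[z = 1] (mod 4)"
        "x\<^sup>2 + y\<^sup>2 + z\<^sup>2 = N" by (auto simp: odd_vectors_def)
      define c where "c = nat ((y - z) div 4)"
      define t where "t = z + 2 * int c"
      have "[y = z] (mod 4)" using w(4,5) by (metis cong_sym cong_trans)
      then have "4 * ((y - z) div 4) = y - z" by (simp add: cong_iff_dvd_diff)
      then have yz: "y = t + 2 * int c" "z = t - 2 * int c" using w(2) by (simp_all add: c_def t_def)
      have odd: "odd x" "odd t" using odd1[OF w(3)] odd1[OF w(5)] by (simp_all add: t_def)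
      have "int ((nat \<bar>x\<bar>)\<^sup>2 + (2 * (nat \<bar>t\<bar>)\<^sup>2 + 8 * c\<^sup>2)) = N"
        using w(6) unfolding yz by (simp add: power2_sum power2_diff power_mult_distrib)
      then have "(nat \<bar>x\<bar>, nat \<bar>t\<bar>, c) \<in> ?T"
        using odd n by (simp add: even_nat_iff del: of_nat_add of_nat_mult)
      \<comment> \<open>The wrong signs fail the congruence, so \<open>G\<close> restores the signs
        lost in the absolute values.\<close>
      moreover have "\<not> [- x = 1] (mod 4)" "\<not> [- t + 2 * int c = 1] (mod 4)"
        using neg[OF w(3)] neg[OF w(4)] shift[of "- t + 2 * int c" "- y" "- int c"] by (auto simp: yz(1))
      then have "G (nat \<bar>x\<bar>, nat \<bar>t\<bar>, c) = w"
        using w(3,4) unfolding yz w(1) G_def by (auto simp: abs_if Let_def)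
      ultimately show "w \<in> G ` ?T" by (intro image_eqI[OF sym])
    qed
  qed
  then have T: "card ?T = card ?W" by (rule bij_betw_same_card)
  have fin: "finite ?V" by (rule finite_odd_vectors)
  have sub: "finite ?W" "finite ?L" "finite ?R" "finite ?Z"
    by (rule finite_subset[OF _ fin]; auto)+
  have "card ?L = card ?R"
    by (rule bij_betw_same_card[of swap23], rule bij_betw_byWitness[of _ swap23])
      (auto simp: swap23_def odd_vectors_def)
  moreover have "?W \<inter> ?L = {}" "?R \<inter> ?Z = {}" by (auto simp: swap23_def)
  note card_Un_disjoint[OF sub(1,2) this(1)] card_Un_disjoint[OF sub(3,4) this(2)]
  moreover have "?W \<union> ?L = ?V" "?R \<union> ?Z = ?W" by (auto simp: swap23_def)
  ultimately have "card ?V = card ?W + card ?R" "card ?W = card ?R + card ?Z" by simp_all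
  then show ?thesis using T by simp
qed

lemma not_square_if_odd_multiplicity:
  fixes m p :: nat
  assumes "prime p" "odd (multiplicity p m)"
  shows "\<nexists>a :: int. int m = a\<^sup>2"
proof
  assume "\<exists>a :: int. int m = a\<^sup>2"
  then obtain a :: int where "int m = a\<^sup>2" ..
  then have "int m = int ((nat \<bar>a\<bar>)\<^sup>2)" by simp
  then have "m = (nat \<bar>a\<bar>)\<^sup>2" by (simp only: of_nat_eq_iff)
  then have "multiplicity p m = 2 * multiplicity p (nat \<bar>a\<bar>)"
    using assms(1) by (cases "a = 0") (auto simp: prime_elem_multiplicity_power_distrib)
  with assms(2) show False by simp
qed

theorem theorem2p3:
  fixes n :: nat
  assumes "[n = 3] (mod 8)"
    and "card {p. prime p \<and> odd (multiplicity p n)} \<ge> 3"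
  shows "n \<notin> B_set"
proof -
  have "[n = 3] (mod 2)" using assms(1) by (rule cong_dvd_modulus_nat) simp
  then have "odd n" by (simp add: cong_def odd_iff_mod_2_eq_one)
  then have "n > 0" by (rule odd_pos)
  obtain P where P: "P \<subseteq> {p. prime p \<and> odd (multiplicity p n)}" "card P = 3"
    using assms(2) by (rule obtain_subset_with_card_n)
  then obtain p q r where pqr: "prime p" "prime q" "prime r" "p \<noteq> q" "p \<noteq> r" "q \<noteq> r"
    "odd (multiplicity p n)" "odd (multiplicity q n)" "odd (multiplicity r n)"
    by (auto simp: card_3_iff)
  \<comment> \<open>The full powers of \<open>p\<close> and \<open>q\<close> give unitary divisors;
    the third prime \<open>r\<close> stays in the cofactor \<open>E\<close> and keeps it from being
    a square.\<close>
  define D1 D2 where "D1 = p ^ multiplicity p n" "D2 = q ^ multiplicity q n"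
  note D = D1_D2_def
  have pq: "coprime D1 D2" unfolding D using pqr by (simp add: primes_coprime)
  then have "D1 * D2 dvd n" by (simp add: D divides_mult multiplicity_dvd)
  then obtain E where E: "n = D1 * D2 * E" ..
  have pos: "D1 > 0" "D2 > 0" "E > 0" using E \<open>n > 0\<close> by auto
  have odd: "odd D1" "odd D2" using E \<open>odd n\<close> by auto
  have mult: "multiplicity s n = multiplicity s D1 + multiplicity s D2 + multiplicity s E" if "prime s" for s
    using that pos unfolding E by (simp add: prime_elem_multiplicity_mult_distrib)
  have pow: "multiplicity s (t ^ k) = (if s = t then k else 0)" if "prime s" "prime t" for s t k :: nat
    using that by (auto simp: multiplicity_distinct_prime_power)
  have m: "multiplicity p D1 = multiplicity p n" "multiplicity q D1 = 0" "multiplicity r D1 = 0"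
    "multiplicity p D2 = 0" "multiplicity q D2 = multiplicity q n" "multiplicity r D2 = 0"
    using pqr by (simp_all add: D pow)
  have mE: "multiplicity p E = 0" "multiplicity q E = 0" "multiplicity r E = multiplicity r n"
    using mult[OF pqr(1)] mult[OF pqr(2)] mult[OF pqr(3)] m by linarith+
  have "\<not> p dvd E" "\<not> q dvd E"
    using mE pqr pos by (auto simp: prime_elem_multiplicity_eq_zero_iff)
  then have cop: "coprime D1 E" "coprime D2 E"
    using pqr by (simp_all add: D prime_imp_coprime)
  have n: "int n = int D1 * int D2 * int E" by (simp add: E)
  have dist: "multiplicity s (a * b) = multiplicity s a + multiplicity s b"
    if "prime s" "a > 0" "b > 0" for s a b :: nat
    using that by (simp add: prime_elem_multiplicity_mult_distrib)
  \<comment> \<open>The prime witnessing the odd exponent is \<open>p\<close> for \<open>D1\<close>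
    and \<open>D1 * D2\<close>, \<open>q\<close> for \<open>D2\<close>, and \<open>r\<close>
    whenever \<open>E\<close> is a factor.\<close>
  have nsq: "\<nexists>a. int D1 = a\<^sup>2" "\<nexists>a. int D2 = a\<^sup>2" "\<nexists>a. int (D1 * D2) = a\<^sup>2"
    "\<nexists>a. int (D2 * E) = a\<^sup>2" "\<nexists>a. int (D1 * E) = a\<^sup>2" "\<nexists>a. int E = a\<^sup>2"
    subgoal using pqr(7-9) by (intro not_square_if_odd_multiplicity[OF pqr(1)]) (simp add: dist[OF pqr(1)] pos m mE)
    subgoal using pqr(7-9) by (intro not_square_if_odd_multiplicity[OF pqr(2)]) (simp add: dist[OF pqr(2)] pos m mE)
    subgoal using pqr(7-9) by (intro not_square_if_odd_multiplicity[OF pqr(1)]) (simp add: dist[OF pqr(1)] pos m mE)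
    subgoal using pqr(7-9) by (intro not_square_if_odd_multiplicity[OF pqr(3)]) (simp add: dist[OF pqr(3)] pos m mE)
    subgoal using pqr(7-9) by (intro not_square_if_odd_multiplicity[OF pqr(3)]) (simp add: dist[OF pqr(3)] pos m mE)
    subgoal using pqr(7-9) by (intro not_square_if_odd_multiplicity[OF pqr(3)]) (simp add: dist[OF pqr(3)] pos m mE)
    done
  have four: "4 dvd card S" if S: "S \<subseteq> odd_vectors (int n)"
    and closed: "\<And>D F v w. D * F = int n \<Longrightarrow> D > 0 \<Longrightarrow> coprime D F \<Longrightarrow>
      v \<in> S \<Longrightarrow> w \<in> odd_vectors (int n) \<Longrightarrow> neighbour D v w \<Longrightarrow> w \<in> S" for S
  proof (rule four_dvd_card_neighbour_closed[of S "int D1" "int D2" "int E"])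
    show "w \<in> S" if "D * F = int D1 * int D2 * int E" "D > 0" "coprime D F" "v \<in> S"
      "w \<in> odd_vectors (int D1 * int D2 * int E)" "neighbour D v w" for D F v w
      using that unfolding n[symmetric] by (rule closed)
  qed (use S pos odd pq cop nsq n in simp_all)
  have half: "even k" if "4 dvd 2 * k" for k :: nat using that by presburger
  have "4 dvd card (odd_vectors (int n))" by (rule four) auto
  moreover have "4 dvd card {v \<in> odd_vectors (int n). swap23 v = v}"
  proof (rule four)
    fix D F :: int and v w
    assume D: "D * F = int n" "D > 0" "coprime D F" and v: "v \<in> {v \<in> odd_vectors (int n). swap23 v = v}"
      and w: "w \<in> odd_vectors (int n)" "neighbour D v w"
    \<comment> \<open>For \<open>v\<close> fixed by the exchange, both \<open>w\<close> and
      \<open>swap23 w\<close> are neighbours of \<open>v\<close>, and uniqueness identifies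
      them.\<close>
    have "neighbour D v (swap23 w)" using neighbour_swap23[OF w(2)] v by simp
    then have "swap23 w = w" using neighbour_unique[of v D F] D v w(2) by auto
    then show "w \<in> {v \<in> odd_vectors (int n). swap23 v = v}" using w(1) by simp
  qed auto
  ultimately have "4 dvd 2 * card {(a, b, c). odd a \<and> odd b \<and> a\<^sup>2 + (2 * b\<^sup>2 + 8 * c\<^sup>2) = n}"
    unfolding card_square_triples[OF refl] by (rule dvd_add)
  then have "even (card {(a, b, c). odd a \<and> odd b \<and> a\<^sup>2 + (2 * b\<^sup>2 + 8 * c\<^sup>2) = n})" by (rule half)
  with assms(1) show ?thesis by (rule even_card_imp_not_in_B_set)
qed

end
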